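(* Let $\mathrm{k}$ be a field, let $I$ be a nonzero proper squarefree monomial ideal of $S=\mathrm{k}[x_1,\dots,x_n]$, and let $s\ge 1$ be an integer. Then $$\operatorname{reg} I+s-1\le \min\bigl(\operatorname{reg} I^s,\ \operatorname{reg} I^{(s)}\bigr).$$
   Context: $S=\mathrm{k}[x_1,\dots,x_n]$ is standard graded with maximal homogeneous ideal $\mathfrak m=(x_1,\dots,x_n)$. For a finitely generated graded $S$-module $L$, $\operatorname{reg}(L)=\max\{i+j\mid H^i_{\mathfrak m}(L)_j\neq 0\}$ is the Castelnuovo-Mumford regularity; for a nonzero proper homogeneous ideal $J$, $\operatorname{reg}(J)=\operatorname{reg}(S/J)+1$. For a nonzero proper homogeneous ideal $I$ with minimal primes $P_1,\dots,P_r$, the $s$-th symbolic power is $I^{(s)}=\bigcap_{i=1}^r I^sS_{P_i}\cap S$. *)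

theory Defs
  imports
    "HOL-Algebra.Ideal_Product"
    "HOL-Algebra.QuotRing"
    "HOL-Algebra.Module"
    "HOL-Library.Poly_Mapping"
begin

section \<open>The standard graded polynomial ring\<close>

text \<open>A polynomial maps exponent vectors to coefficients. The ring in \<open>n\<close> variables consists of
  those polynomials in which only the variables with index in \<open>{1..n}\<close> occur.\<close>

type_synonym exponent = "nat \<Rightarrow>\<^sub>0 nat"
type_synonym 'k mpoly = "exponent \<Rightarrow>\<^sub>0 'k"

definition mpoly_ring :: "nat \<Rightarrow> 'k::field mpoly ring" where
  "mpoly_ring n =
    \<lparr>carrier = {p. \<forall>m\<in>Poly_Mapping.keys p. Poly_Mapping.keys m \<subseteq> {1..n}},
     mult = (*), one = 1, zero = 0, add = (+)\<rparr>"

definition monomial :: "exponent \<Rightarrow> 'k::field mpoly" where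
  "monomial m = Poly_Mapping.single m 1"

definition mdeg :: "exponent \<Rightarrow> nat" where
  "mdeg m = (\<Sum>v\<in>Poly_Mapping.keys m. Poly_Mapping.lookup m v)"

definition homogeneous :: "nat \<Rightarrow> int \<Rightarrow> 'k::field mpoly set" where
  "homogeneous n e = {p \<in> carrier (mpoly_ring n). \<forall>m\<in>Poly_Mapping.keys p. int (mdeg m) = e}"

definition squarefree_exponent :: "exponent \<Rightarrow> bool" where
  "squarefree_exponent m \<longleftrightarrow> (\<forall>v. Poly_Mapping.lookup m v \<le> 1)"

definition squarefree_monomial_ideal :: "nat \<Rightarrow> 'k::field mpoly set \<Rightarrow> bool" where
  "squarefree_monomial_ideal n I \<longleftrightarrow>
    (\<exists>A. (\<forall>m\<in>A. Poly_Mapping.keys m \<subseteq> {1..n} \<and> squarefree_exponent m) \<and>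
         I = genideal (mpoly_ring n) (monomial ` A))"


section \<open>Localization of modules\<close>

text \<open>For a module \<open>M\<close> over a commutative ring \<open>R\<close> and a multiplicatively closed subset \<open>T\<close> of \<open>R\<close>
  containing the unit, \<open>frac R M T a t\<close> is the fraction \<open>a/t\<close>, an equivalence class of pairs.
  The operations on classes are unions over all representatives; each such union is a union of
  copies of a single class.\<close>

definition frac_rel ::
    "('a, 'c) ring_scheme \<Rightarrow> ('a, 'b, 'd) module_scheme \<Rightarrow> 'a set \<Rightarrow> (('b \<times> 'a) \<times> ('b \<times> 'a)) set" where
  "frac_rel R M T = {((a, t), (b, u)). a \<in> carrier M \<and> b \<in> carrier M \<and> t \<in> T \<and> u \<in> T \<and>
    (\<exists>w\<in>T. w \<odot>\<^bsub>M\<^esub> (u \<odot>\<^bsub>M\<^esub> a) = w \<odot>\<^bsub>M\<^esub> (t \<odot>\<^bsub>M\<^esub> b))}"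

definition frac ::
    "('a, 'c) ring_scheme \<Rightarrow> ('a, 'b, 'd) module_scheme \<Rightarrow> 'a set \<Rightarrow> 'b \<Rightarrow> 'a \<Rightarrow> ('b \<times> 'a) set" where
  "frac R M T a t = frac_rel R M T `` {(a, t)}"

text \<open>The fields \<open>mult\<close> and \<open>one\<close> of a module record carry no meaning.\<close>

definition localization ::
    "('a, 'c) ring_scheme \<Rightarrow> ('a, 'b, 'd) module_scheme \<Rightarrow> 'a set \<Rightarrow> ('a, ('b \<times> 'a) set) module" where
  "localization R M T =
    \<lparr>carrier = (carrier M \<times> T) // frac_rel R M T,
     mult = undefined, one = undefined,
     zero = frac R M T \<zero>\<^bsub>M\<^esub> \<one>\<^bsub>R\<^esub>,
     add = (\<lambda>X Y. \<Union>(a, t)\<in>X. \<Union>(b, u)\<in>Y.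
              frac R M T ((u \<odot>\<^bsub>M\<^esub> a) \<oplus>\<^bsub>M\<^esub> (t \<odot>\<^bsub>M\<^esub> b)) (t \<otimes>\<^bsub>R\<^esub> u)),
     smult = (\<lambda>r X. \<Union>(a, t)\<in>X. frac R M T (r \<odot>\<^bsub>M\<^esub> a) t)\<rparr>"

text \<open>The canonical map \<open>a/t \<mapsto> a/t\<close> into the localization at a larger set \<open>T'\<close>.\<close>

definition localization_map ::
    "('a, 'c) ring_scheme \<Rightarrow> ('a, 'b, 'd) module_scheme \<Rightarrow> 'a set \<Rightarrow> ('b \<times> 'a) set \<Rightarrow> ('b \<times> 'a) set" where
  "localization_map R M T' X = (\<Union>(a, t)\<in>X. frac R M T' a t)"


section \<open>Graded modules and local cohomology\<close>

record ('a, 'b) graded_module = "('a, 'b) module" +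
  degree_part :: "int \<Rightarrow> 'b set"

text \<open>The graded module \<open>S/J\<close> for a homogeneous ideal \<open>J\<close> of the polynomial ring \<open>S\<close>.\<close>

definition quotient_module ::
    "nat \<Rightarrow> 'k::field mpoly set \<Rightarrow> ('k mpoly, 'k mpoly set) graded_module" where
  "quotient_module n J = (let S = mpoly_ring n; Q = S Quot J in
    \<lparr>carrier = carrier Q, mult = mult Q, one = one Q, zero = zero Q, add = add Q,
     smult = (\<lambda>r X. (J +>\<^bsub>S\<^esub> r) \<otimes>\<^bsub>Q\<^esub> X),
     degree_part = (\<lambda>e. (\<lambda>p. J +>\<^bsub>S\<^esub> p) ` homogeneous n e)\<rparr>)"

text \<open>Local cohomology with support in the maximal homogeneous ideal is computed by the Cech complex
  \<open>C\<^sup>i = \<Oplus> L\<^sub>F\<close> on the variables, where \<open>F\<close> runs over the \<open>i\<close>-subsets of \<open>{1..n}\<close> and \<open>L\<^sub>F\<close> is the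
  localization of \<open>L\<close> at the product of the variables in \<open>F\<close>. As denominators we allow all
  monomials in the variables from \<open>F\<close> instead of only the powers of that product; this
  gives the same localization.\<close>

definition index_sets :: "nat \<Rightarrow> nat \<Rightarrow> nat set set" where
  "index_sets n i = {F. F \<subseteq> {1..n} \<and> card F = i}"

definition monomials :: "nat set \<Rightarrow> 'k::field mpoly set" where
  "monomials F = {monomial m | m. Poly_Mapping.keys m \<subseteq> F}"

definition cech_module ::
    "nat \<Rightarrow> ('k::field mpoly, 'b, 'd) graded_module_scheme \<Rightarrow> nat set \<Rightarrow>
     ('k mpoly, ('b \<times> 'k mpoly) set) graded_module" where
  "cech_module n L F = (let S = mpoly_ring n; T = monomials F in
    module.extend (localization S L T)
      (graded_module.fields
        (\<lambda>j. {frac S L T a (monomial m) | a m.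
               Poly_Mapping.keys m \<subseteq> F \<and> a \<in> degree_part L (j + int (mdeg m))})))"

text \<open>The degree \<open>j\<close> part of \<open>C\<^sup>i\<close>, an additive group which is written multiplicatively so that
  \<open>FactGroup\<close> applies.\<close>

definition cech_group ::
    "nat \<Rightarrow> ('k::field mpoly, 'b, 'd) graded_module_scheme \<Rightarrow> nat \<Rightarrow> int \<Rightarrow>
     (nat set \<Rightarrow> ('b \<times> 'k mpoly) set) monoid" where
  "cech_group n L i j =
    \<lparr>carrier = (\<Pi>\<^sub>E F\<in>index_sets n i. degree_part (cech_module n L F) j),
     mult = (\<lambda>c c'. \<lambda>F\<in>index_sets n i. c F \<oplus>\<^bsub>cech_module n L F\<^esub> c' F),
     one = (\<lambda>F\<in>index_sets n i. \<zero>\<^bsub>cech_module n L F\<^esub>)\<rparr>"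

definition cech_diff ::
    "nat \<Rightarrow> ('k::field mpoly, 'b, 'd) graded_module_scheme \<Rightarrow> nat \<Rightarrow>
     (nat set \<Rightarrow> ('b \<times> 'k mpoly) set) \<Rightarrow> nat set \<Rightarrow> ('b \<times> 'k mpoly) set" where
  "cech_diff n L i c = (\<lambda>G\<in>index_sets n (Suc i).
    \<Oplus>\<^bsub>cech_module n L G\<^esub> v\<in>G. (-1) ^ card {w\<in>G. w < v} \<odot>\<^bsub>cech_module n L G\<^esub>
      localization_map (mpoly_ring n) L (monomials G) (c (G - {v})))"

definition cech_cocycles ::
    "nat \<Rightarrow> ('k::field mpoly, 'b, 'd) graded_module_scheme \<Rightarrow> nat \<Rightarrow> int \<Rightarrow>
     (nat set \<Rightarrow> ('b \<times> 'k mpoly) set) set" where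
  "cech_cocycles n L i j =
    {c \<in> carrier (cech_group n L i j). cech_diff n L i c = \<one>\<^bsub>cech_group n L (Suc i) j\<^esub>}"

definition cech_coboundaries ::
    "nat \<Rightarrow> ('k::field mpoly, 'b, 'd) graded_module_scheme \<Rightarrow> nat \<Rightarrow> int \<Rightarrow>
     (nat set \<Rightarrow> ('b \<times> 'k mpoly) set) set" where
  "cech_coboundaries n L i j =
    (case i of 0 \<Rightarrow> {\<one>\<^bsub>cech_group n L 0 j\<^esub>}
       | Suc h \<Rightarrow> cech_diff n L h ` carrier (cech_group n L h j))"

text \<open>The degree \<open>j\<close> part of the \<open>i\<close>-th local cohomology module of \<open>L\<close>.\<close>

definition local_cohomology ::
    "nat \<Rightarrow> ('k::field mpoly, 'b, 'd) graded_module_scheme \<Rightarrow> nat \<Rightarrow> int \<Rightarrow>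
     (nat set \<Rightarrow> ('b \<times> 'k mpoly) set) set monoid" where
  "local_cohomology n L i j =
    (cech_group n L i j)\<lparr>carrier := cech_cocycles n L i j\<rparr> Mod cech_coboundaries n L i j"

text \<open>For a nonzero finitely generated graded module the set below is nonempty and bounded above,
  so that its supremum in the integers is its maximum.\<close>

definition reg_module :: "nat \<Rightarrow> ('k::field mpoly, 'b, 'd) graded_module_scheme \<Rightarrow> int" where
  "reg_module n L =
    Sup {int i + j | i j. carrier (local_cohomology n L i j) \<noteq> {\<one>\<^bsub>local_cohomology n L i j\<^esub>}}"

definition reg_ideal :: "nat \<Rightarrow> 'k::field mpoly set \<Rightarrow> int" where
  "reg_ideal n J = reg_module n (quotient_module n J) + 1"


section \<open>Ordinary and symbolic powers\<close>

definition ideal_power :: "nat \<Rightarrow> 'k::field mpoly set \<Rightarrow> nat \<Rightarrow> 'k mpoly set" where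
  "ideal_power n I s = I [^]\<^bsub>ideals_set (mpoly_ring n)\<^esub> s"

definition minimal_primes :: "('a, 'c) ring_scheme \<Rightarrow> 'a set \<Rightarrow> 'a set set" where
  "minimal_primes R I = {P. primeideal P R \<and> I \<subseteq> P \<and>
    (\<forall>Q. primeideal Q R \<and> I \<subseteq> Q \<and> Q \<subseteq> P \<longrightarrow> Q = P)}"

definition regular_module :: "('a, 'c) ring_scheme \<Rightarrow> ('a, 'a) module" where
  "regular_module R =
    \<lparr>carrier = carrier R, mult = mult R, one = one R, zero = zero R, add = add R, smult = mult R\<rparr>"

text \<open>The contraction of \<open>J R\<^sub>P\<close> to \<open>R\<close>; the extended ideal \<open>J R\<^sub>P\<close> is the set of all
  fractions with numerator in \<open>J\<close>.\<close>

definition localized_contraction :: "('a, 'c) ring_scheme \<Rightarrow> 'a set \<Rightarrow> 'a set \<Rightarrow> 'a set" where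
  "localized_contraction R J P = (let fr = frac R (regular_module R) (carrier R - P) in
    {f \<in> carrier R. fr f \<one>\<^bsub>R\<^esub> \<in> {fr a t | a t. a \<in> J \<and> t \<in> carrier R - P}})"

definition symbolic_power :: "nat \<Rightarrow> 'k::field mpoly set \<Rightarrow> nat \<Rightarrow> 'k mpoly set" where
  "symbolic_power n I s =
    (\<Inter>P\<in>minimal_primes (mpoly_ring n) I.
       localized_contraction (mpoly_ring n) (ideal_power n I s) P)"

end

theory Submission
  imports Defs
begin

text \<open>
  For a monomial ideal \<open>J\<close> the Cech complex of \<open>S/J\<close> splits over the fine grading by \<open>\<int>\<^sup>n\<close>. In a
  degree \<open>a\<close> it has one copy of \<open>k\<close> for every set \<open>F\<close> of variables that contains the negative support
  of \<open>a\<close> and for which \<open>x\<^sup>a\<close> is not in the localization of \<open>J\<close> at \<open>F\<close>. If some \<open>a\<^sub>v\<close> is at least the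
  exponent of \<open>x\<^sub>v\<close> in all generators of \<open>J\<close>, then this family of sets is stable under toggling \<open>v\<close> and
  the complex is exact. For squarefree \<open>I\<close> this forces \<open>a \<le> 0\<close>, and some \<open>a\<^sub>v\<close> vanishes as \<open>I \<noteq> 0\<close>.
  Let \<open>J\<close> be \<open>I\<^sup>s\<close> or \<open>I\<^sup>(\<^sup>s\<^sup>)\<close>. The family of \<open>I\<close> in degree \<open>a\<close> consists of faces \<open>F\<close>, and it equals the
  family of \<open>J\<close> in degree \<open>a + (s - 1) e\<^sub>v\<close>: for a nonface \<open>F\<close> a monomial on \<open>F\<close> lies in \<open>I\<^sup>s \<subseteq> J\<close>, and for a
  face \<open>F\<close> every monomial of \<open>J\<close> has degree at least \<open>s\<close> in the variables off \<open>F\<close>. Hence every nonzero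
  piece of \<open>H\<^sup>i(S/I)\<close> in degree \<open>j\<close> yields one of \<open>H\<^sup>i(S/J)\<close> in degree \<open>j + s - 1\<close>.
\<close>

section \<open>Fractions over a module\<close>

text \<open>Regularity is defined through cosets of cochains whose entries are classes of fractions,
  so no decomposition into fine degrees is available at the start. A coefficient functional replaces
  it: coefficients determine a fraction, and finitely many of them can be prescribed in admissible
  degrees. Cohomology is then compared by moving one combinatorial cocycle, without a map between
  the two Cech complexes. The shift by \<open>s - 1\<close> is extreme: it keeps the degree off a
  face below \<open>s\<close> whether or not \<open>v\<close> is in the face, while an exponent
  \<open>s\<close> would already produce a cone. A suitable \<open>v\<close> exists because the full
  vertex set is not a face of a nonzero ideal: a member of the family misses some \<open>v\<close>,
  which is then outside the negative support as well. The supremum in the integers is informative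
  only for nonempty sets bounded above, so the proof also supplies nonemptiness for I and
  boundedness for its powers. The generators of a symbolic power are not explicit; its exponent
  bound comes from the degrees off the faces.\<close>

lemma UN_pair_const:
  assumes "(a0, t0) \<in> X" "\<And>a t. (a, t) \<in> X \<Longrightarrow> f a t = c"
  shows "(\<Union>(a, t)\<in>X. f a t) = c"
  using assms by auto

text \<open>Serves two localizations: S/J at the monomials in some variables, and S itself at the
  complement of a prime. Zero divisors on the module are allowed, hence the extra multiplier in
  every equality of fractions.\<close>

locale module_fractions = module R M for R (structure) and M (structure) +
  fixes T
  assumes T_subset: "T \<subseteq> carrier R"
    and T_one: "\<one> \<in> T"
    and T_mult: "t \<in> T \<Longrightarrow> u \<in> T \<Longrightarrow> t \<otimes> u \<in> T"
begin

lemma T_carrier: "t \<in> T \<Longrightarrow> t \<in> carrier R"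
  using T_subset by blast

lemma smult_left_commute:
  "\<lbrakk>x \<in> carrier R; y \<in> carrier R; a \<in> carrier M\<rbrakk> \<Longrightarrow> x \<odot>\<^bsub>M\<^esub> (y \<odot>\<^bsub>M\<^esub> a) = y \<odot>\<^bsub>M\<^esub> (x \<odot>\<^bsub>M\<^esub> a)"
  by (metis smult_assoc1 m_comm)

lemma equiv_frac_rel: "equiv (carrier M \<times> T) (frac_rel R M T)"
proof (rule equivI)
  show "frac_rel R M T \<subseteq> (carrier M \<times> T) \<times> (carrier M \<times> T)"
    by (auto simp: frac_rel_def)
  show "refl_on (carrier M \<times> T) (frac_rel R M T)"
    using T_one by (auto simp: refl_on_def frac_rel_def)
  show "sym (frac_rel R M T)"
    unfolding sym_def frac_rel_def by clarsimp metis
  show "trans (frac_rel R M T)"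
  proof (rule transI)
    fix X Y Z assume XY: "(X, Y) \<in> frac_rel R M T" and YZ: "(Y, Z) \<in> frac_rel R M T"
    obtain a t b u c x where X: "X = (a, t)" and Y: "Y = (b, u)" and Z: "Z = (c, x)"
      by (metis surj_pair)
    note [simp] = T_carrier
    have M: "a \<in> carrier M" "b \<in> carrier M" "c \<in> carrier M" "t \<in> T" "u \<in> T" "x \<in> T"
      using XY YZ by (auto simp: X Y Z frac_rel_def)
    obtain w w' where w: "w \<in> T" "w \<odot>\<^bsub>M\<^esub> (u \<odot>\<^bsub>M\<^esub> a) = w \<odot>\<^bsub>M\<^esub> (t \<odot>\<^bsub>M\<^esub> b)"
      and w': "w' \<in> T" "w' \<odot>\<^bsub>M\<^esub> (x \<odot>\<^bsub>M\<^esub> b) = w' \<odot>\<^bsub>M\<^esub> (u \<odot>\<^bsub>M\<^esub> c)"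
      using XY YZ by (auto simp: X Y Z frac_rel_def)
    \<comment> \<open>The middle denominator \<open>u\<close> enters the multiplier because the two
      given equations can be chained only through \<open>u a\<close> and \<open>u c\<close>.\<close>
    have "(w \<otimes> w' \<otimes> u) \<odot>\<^bsub>M\<^esub> (x \<odot>\<^bsub>M\<^esub> a) = w' \<odot>\<^bsub>M\<^esub> (x \<odot>\<^bsub>M\<^esub> (w \<odot>\<^bsub>M\<^esub> (u \<odot>\<^bsub>M\<^esub> a)))"
      using M w(1) w'(1) by (simp add: smult_assoc1 smult_left_commute)
    also have "\<dots> = w \<odot>\<^bsub>M\<^esub> (t \<odot>\<^bsub>M\<^esub> (w' \<odot>\<^bsub>M\<^esub> (x \<odot>\<^bsub>M\<^esub> b)))"
      using M w(1) w'(1) unfolding w(2) by (simp add: smult_left_commute)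
    also have "\<dots> = (w \<otimes> w' \<otimes> u) \<odot>\<^bsub>M\<^esub> (t \<odot>\<^bsub>M\<^esub> c)"
      using M w(1) w'(1) unfolding w'(2) by (simp add: smult_assoc1 smult_left_commute)
    finally show "(X, Z) \<in> frac_rel R M T"
      using M w(1) w'(1) T_mult by (auto simp: X Z frac_rel_def)
  qed
qed

lemma frac_eq_iff:
  assumes "a \<in> carrier M" "b \<in> carrier M" "t \<in> T" "u \<in> T"
  shows "frac R M T a t = frac R M T b u \<longleftrightarrow> (\<exists>w\<in>T. w \<odot>\<^bsub>M\<^esub> (u \<odot>\<^bsub>M\<^esub> a) = w \<odot>\<^bsub>M\<^esub> (t \<odot>\<^bsub>M\<^esub> b))"
  unfolding frac_def
  by (subst eq_equiv_class_iff[OF equiv_frac_rel]) (use assms in \<open>auto simp: frac_rel_def\<close>)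

lemma frac_eqI:
  assumes "a \<in> carrier M" "b \<in> carrier M" "t \<in> T" "u \<in> T" "u \<odot>\<^bsub>M\<^esub> a = t \<odot>\<^bsub>M\<^esub> b"
  shows "frac R M T a t = frac R M T b u"
  using frac_eq_iff[OF assms(1-4)] T_one assms(5) by auto

lemma mem_frac:
  "\<lbrakk>a \<in> carrier M; t \<in> T\<rbrakk> \<Longrightarrow> (a, t) \<in> frac R M T a t"
  using equiv_class_self[OF equiv_frac_rel, of "(a, t)"] by (auto simp: frac_def)

lemma mem_fracD:
  assumes "(a', t') \<in> frac R M T a t"
  shows "a' \<in> carrier M" "t' \<in> T" "\<exists>w\<in>T. w \<odot>\<^bsub>M\<^esub> (t' \<odot>\<^bsub>M\<^esub> a) = w \<odot>\<^bsub>M\<^esub> (t \<odot>\<^bsub>M\<^esub> a')"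
  using assms by (auto simp: frac_def frac_rel_def)

lemma carrier_localization:
  "carrier (localization R M T) = {frac R M T a t |a t. a \<in> carrier M \<and> t \<in> T}"
  by (auto simp: localization_def quotient_def frac_def)

lemma frac_closed: "\<lbrakk>a \<in> carrier M; t \<in> T\<rbrakk> \<Longrightarrow> frac R M T a t \<in> carrier (localization R M T)"
  unfolding carrier_localization by blast

lemma frac_zero: "t \<in> T \<Longrightarrow> \<zero>\<^bsub>localization R M T\<^esub> = frac R M T \<zero>\<^bsub>M\<^esub> t"
  unfolding localization_def
  by (simp, rule frac_eqI) (use T_one T_carrier in \<open>auto simp: smult_r_null\<close>)

lemma frac_add:
  assumes "a \<in> carrier M" "b \<in> carrier M" "t \<in> T" "u \<in> T"
  shows "frac R M T a t \<oplus>\<^bsub>localization R M T\<^esub> frac R M T b u =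
    frac R M T ((u \<odot>\<^bsub>M\<^esub> a) \<oplus>\<^bsub>M\<^esub> (t \<odot>\<^bsub>M\<^esub> b)) (t \<otimes> u)"
proof -
  note [simp] = T_carrier T_mult
  have "frac R M T ((u' \<odot>\<^bsub>M\<^esub> a') \<oplus>\<^bsub>M\<^esub> (t' \<odot>\<^bsub>M\<^esub> b')) (t' \<otimes> u') =
      frac R M T ((u \<odot>\<^bsub>M\<^esub> a) \<oplus>\<^bsub>M\<^esub> (t \<odot>\<^bsub>M\<^esub> b)) (t \<otimes> u)"
    if A: "(a', t') \<in> frac R M T a t" and B: "(b', u') \<in> frac R M T b u" for a' t' b' u'
  proof -
    note M = assms mem_fracD(1,2)[OF A] mem_fracD(1,2)[OF B]
    obtain w where w: "w \<in> T" "w \<odot>\<^bsub>M\<^esub> (t' \<odot>\<^bsub>M\<^esub> a) = w \<odot>\<^bsub>M\<^esub> (t \<odot>\<^bsub>M\<^esub> a')"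
      using mem_fracD(3)[OF A] by blast
    obtain x where x: "x \<in> T" "x \<odot>\<^bsub>M\<^esub> (u' \<odot>\<^bsub>M\<^esub> b) = x \<odot>\<^bsub>M\<^esub> (u \<odot>\<^bsub>M\<^esub> b')"
      using mem_fracD(3)[OF B] by blast
    have 1: "(w \<otimes> x) \<odot>\<^bsub>M\<^esub> ((t \<otimes> u) \<odot>\<^bsub>M\<^esub> (u' \<odot>\<^bsub>M\<^esub> a')) = (w \<otimes> x) \<odot>\<^bsub>M\<^esub> ((t' \<otimes> u') \<odot>\<^bsub>M\<^esub> (u \<odot>\<^bsub>M\<^esub> a))"
    proof -
      have "(w \<otimes> x) \<odot>\<^bsub>M\<^esub> ((t \<otimes> u) \<odot>\<^bsub>M\<^esub> (u' \<odot>\<^bsub>M\<^esub> a')) = x \<odot>\<^bsub>M\<^esub> (u \<odot>\<^bsub>M\<^esub> (u' \<odot>\<^bsub>M\<^esub> (w \<odot>\<^bsub>M\<^esub> (t \<odot>\<^bsub>M\<^esub> a'))))"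
        using M w(1) x(1) by (simp add: smult_assoc1 smult_left_commute)
      also have "\<dots> = (w \<otimes> x) \<odot>\<^bsub>M\<^esub> ((t' \<otimes> u') \<odot>\<^bsub>M\<^esub> (u \<odot>\<^bsub>M\<^esub> a))"
        using M w(1) x(1) unfolding w(2)[symmetric] by (simp add: smult_assoc1 smult_left_commute)
      finally show ?thesis .
    qed
    have 2: "(w \<otimes> x) \<odot>\<^bsub>M\<^esub> ((t \<otimes> u) \<odot>\<^bsub>M\<^esub> (t' \<odot>\<^bsub>M\<^esub> b')) = (w \<otimes> x) \<odot>\<^bsub>M\<^esub> ((t' \<otimes> u') \<odot>\<^bsub>M\<^esub> (t \<odot>\<^bsub>M\<^esub> b))"
    proof -
      have "(w \<otimes> x) \<odot>\<^bsub>M\<^esub> ((t \<otimes> u) \<odot>\<^bsub>M\<^esub> (t' \<odot>\<^bsub>M\<^esub> b')) = w \<odot>\<^bsub>M\<^esub> (t \<odot>\<^bsub>M\<^esub> (t' \<odot>\<^bsub>M\<^esub> (x \<odot>\<^bsub>M\<^esub> (u \<odot>\<^bsub>M\<^esub> b'))))"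
        using M w(1) x(1) by (simp add: smult_assoc1 smult_left_commute)
      also have "\<dots> = (w \<otimes> x) \<odot>\<^bsub>M\<^esub> ((t' \<otimes> u') \<odot>\<^bsub>M\<^esub> (t \<odot>\<^bsub>M\<^esub> b))"
        using M w(1) x(1) unfolding x(2)[symmetric] by (simp add: smult_assoc1 smult_left_commute)
      finally show ?thesis .
    qed
    show ?thesis
      by (subst frac_eq_iff, use M in simp, use M in simp, use M in simp, use M in simp)
        (use M w(1) x(1) 1 2 in \<open>auto intro!: bexI[of _ "w \<otimes> x"] simp: smult_r_distr\<close>)
  qed
  then show ?thesis
    unfolding localization_def
    by (simp, intro UN_pair_const[OF mem_frac[OF assms(1,3)]] UN_pair_const[OF mem_frac[OF assms(2,4)]])
qed

lemma frac_smult: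
  assumes "r \<in> carrier R" "a \<in> carrier M" "t \<in> T"
  shows "r \<odot>\<^bsub>localization R M T\<^esub> frac R M T a t = frac R M T (r \<odot>\<^bsub>M\<^esub> a) t"
proof -
  note [simp] = T_carrier T_mult
  have eq: "frac R M T (r \<odot>\<^bsub>M\<^esub> a') t' = frac R M T (r \<odot>\<^bsub>M\<^esub> a) t"
    if A: "(a', t') \<in> frac R M T a t" for a' t'
  proof -
    note M = assms mem_fracD(1,2)[OF A]
    obtain w where w: "w \<in> T" "w \<odot>\<^bsub>M\<^esub> (t' \<odot>\<^bsub>M\<^esub> a) = w \<odot>\<^bsub>M\<^esub> (t \<odot>\<^bsub>M\<^esub> a')"
      using mem_fracD(3)[OF A] by blast
    have "w \<odot>\<^bsub>M\<^esub> (t \<odot>\<^bsub>M\<^esub> (r \<odot>\<^bsub>M\<^esub> a')) = r \<odot>\<^bsub>M\<^esub> (w \<odot>\<^bsub>M\<^esub> (t \<odot>\<^bsub>M\<^esub> a'))"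
      using M w(1) by (simp add: smult_left_commute)
    also have "\<dots> = w \<odot>\<^bsub>M\<^esub> (t' \<odot>\<^bsub>M\<^esub> (r \<odot>\<^bsub>M\<^esub> a))"
      unfolding w(2)[symmetric] using M w(1) by (simp add: smult_left_commute)
    finally show ?thesis
      by (subst frac_eq_iff) (use M w(1) in auto)
  qed
  show ?thesis
    unfolding localization_def by (simp, intro UN_pair_const[OF mem_frac[OF assms(2,3)]] eq)
qed

lemma localization_map_frac:
  assumes "T \<subseteq> T'" "module_fractions R M T'" "a \<in> carrier M" "t \<in> T"
  shows "localization_map R M T' (frac R M T a t) = frac R M T' a t"
proof -
  interpret T': module_fractions R M T' by fact
  have "frac R M T' a' t' = frac R M T' a t" if "(a', t') \<in> frac R M T a t" for a' t'
    by (subst T'.frac_eq_iff) (use assms mem_fracD[OF that] in \<open>metis subsetD\<close>)+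
  then show ?thesis
    unfolding localization_map_def by (intro UN_pair_const[OF mem_frac[OF assms(3,4)]])
qed

lemma abelian_group_localization: "abelian_group (localization R M T)"
proof (rule abelian_groupI)
  note [simp] = T_carrier T_mult T_one frac_add
  let ?L = "localization R M T"
  have cases: "\<exists>a t. x = frac R M T a t \<and> a \<in> carrier M \<and> t \<in> T" if "x \<in> carrier ?L" for x
    using that by (auto simp: carrier_localization)
  show "\<zero>\<^bsub>?L\<^esub> \<in> carrier ?L"
    unfolding frac_zero[OF T_one] by (simp add: frac_closed)
  fix x assume x: "x \<in> carrier ?L"
  obtain a t where a: "x = frac R M T a t" "a \<in> carrier M" "t \<in> T" using cases[OF x] by blast
  show "\<zero>\<^bsub>?L\<^esub> \<oplus>\<^bsub>?L\<^esub> x = x"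
    unfolding frac_zero[OF T_one] using a by (simp add: smult_r_null)
  have "frac R M T (\<ominus>\<^bsub>M\<^esub> a) t \<oplus>\<^bsub>?L\<^esub> x = frac R M T \<zero>\<^bsub>M\<^esub> (t \<otimes> t)"
    using a by (simp add: smult_r_minus M.l_neg)
  then show "\<exists>y\<in>carrier ?L. y \<oplus>\<^bsub>?L\<^esub> x = \<zero>\<^bsub>?L\<^esub>"
    unfolding frac_zero[OF T_mult[OF a(3,3)]] by (rule bexI) (rule frac_closed, use a in auto)
  fix y assume y: "y \<in> carrier ?L"
  obtain b u where b: "y = frac R M T b u" "b \<in> carrier M" "u \<in> T" using cases[OF y] by blast
  have "(u \<odot>\<^bsub>M\<^esub> a) \<oplus>\<^bsub>M\<^esub> (t \<odot>\<^bsub>M\<^esub> b) \<in> carrier M" "t \<otimes> u \<in> T"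
    using a b by auto
  then show "x \<oplus>\<^bsub>?L\<^esub> y \<in> carrier ?L"
    using a b by (simp add: frac_closed)
  show "x \<oplus>\<^bsub>?L\<^esub> y = y \<oplus>\<^bsub>?L\<^esub> x"
    using a b by (simp add: m_comm M.a_comm)
  fix z assume z: "z \<in> carrier ?L"
  obtain c v where c: "z = frac R M T c v" "c \<in> carrier M" "v \<in> T" using cases[OF z] by blast
  show "(x \<oplus>\<^bsub>?L\<^esub> y) \<oplus>\<^bsub>?L\<^esub> z = x \<oplus>\<^bsub>?L\<^esub> (y \<oplus>\<^bsub>?L\<^esub> z)"
    using a b c by (simp add: smult_r_distr M.a_assoc m_assoc smult_assoc1 smult_left_commute)
qed

end


section \<open>Monomial ideals and their Cech modules\<close>

abbreviation (input) "lookup \<equiv> Poly_Mapping.lookup"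
abbreviation (input) "keys \<equiv> Poly_Mapping.keys"

section \<open>Exponent sets of monomial ideals\<close>

definition exponents :: "nat \<Rightarrow> exponent set" where
  "exponents n = {m. keys m \<subseteq> {1..n}}"

text \<open>Only a k-subspace for arbitrary \<open>M\<close>; it is an ideal of S once
  \<open>M\<close> is an upset, and \<open>M = exponents n\<close> gives S itself, so that ring and
  ideals share the same lemmas.\<close>

definition monomial_ideal :: "exponent set \<Rightarrow> 'k::field mpoly set" where
  "monomial_ideal M = {p. keys p \<subseteq> M}"

definition upset :: "nat \<Rightarrow> exponent set \<Rightarrow> bool" where
  "upset n M \<longleftrightarrow> M \<subseteq> exponents n \<and> (\<forall>m\<in>M. \<forall>w\<in>exponents n. m + w \<in> M)"

lemma upsetD: "upset n M \<Longrightarrow> m \<in> M \<Longrightarrow> w \<in> exponents n \<Longrightarrow> m + w \<in> M"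
  by (auto simp: upset_def)

lemma upset_subset: "upset n M \<Longrightarrow> M \<subseteq> exponents n"
  by (auto simp: upset_def)

lemma keys_eq_empty: "keys p = {} \<Longrightarrow> p = 0"
  by (metis empty_iff lookup_zero not_in_keys_iff_lookup_eq_zero poly_mapping_eqI)

lemma keys_exponent_add: "keys (m + w :: exponent) = keys m \<union> keys w"
  by (auto simp: in_keys_iff lookup_add)

lemma exponents_add [simp]: "m + w \<in> exponents n \<longleftrightarrow> m \<in> exponents n \<and> w \<in> exponents n"
  by (auto simp: exponents_def keys_exponent_add)

lemma zero_exponents [simp]: "0 \<in> exponents n"
  by (simp add: exponents_def)

lemma upset_exponents: "upset n (exponents n)"
  by (auto simp: upset_def)

lemma mpoly_ring_simps [simp]:
  "mult (mpoly_ring n) = (*)" "one (mpoly_ring n) = 1"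
  "zero (mpoly_ring n) = 0" "add (mpoly_ring n) = (+)"
  by (simp_all add: mpoly_ring_def)

lemma carrier_mpoly_ring: "carrier (mpoly_ring n) = monomial_ideal (exponents n)"
  by (auto simp: mpoly_ring_def monomial_ideal_def exponents_def)

lemma monomial_ideal_add:
  "p \<in> monomial_ideal M \<Longrightarrow> q \<in> monomial_ideal M \<Longrightarrow> p + q \<in> monomial_ideal M"
  using keys_add[of p q] by (auto simp: monomial_ideal_def)

lemma monomial_ideal_uminus [simp]: "- p \<in> monomial_ideal M \<longleftrightarrow> p \<in> monomial_ideal M"
  by (auto simp: monomial_ideal_def in_keys_iff)

lemma monomial_ideal_zero [simp]: "0 \<in> monomial_ideal M"
  by (auto simp: monomial_ideal_def)

lemma monomial_ideal_mult:
  assumes "upset n M" "p \<in> monomial_ideal M" "q \<in> monomial_ideal (exponents n)"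
  shows "p * q \<in> monomial_ideal M"
proof -
  have "keys (p * q) \<subseteq> {a + b |a b. a \<in> keys p \<and> b \<in> keys q}"
    by (rule keys_mult)
  also have "\<dots> \<subseteq> M"
    using assms upsetD[OF assms(1)] by (auto simp: monomial_ideal_def)
  finally show ?thesis
    by (simp add: monomial_ideal_def)
qed

lemma monomial_in_monomial_ideal [simp]: "monomial m \<in> monomial_ideal M \<longleftrightarrow> m \<in> M"
  by (simp add: monomial_ideal_def monomial_def)

lemma one_in_mpoly_ring [simp]: "1 \<in> monomial_ideal (exponents n)"
  by (simp add: monomial_ideal_def)

lemma cring_mpoly_ring: "cring (mpoly_ring n :: 'k::field mpoly ring)"
proof (rule cringI)
  show "abelian_group (mpoly_ring n :: 'k mpoly ring)"
  proof (rule abelian_groupI)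
    show "\<exists>y\<in>carrier (mpoly_ring n). y \<oplus>\<^bsub>mpoly_ring n\<^esub> x = \<zero>\<^bsub>mpoly_ring n\<^esub>"
      if "x \<in> carrier (mpoly_ring n)" for x :: "'k mpoly"
      using that by (intro bexI[of _ "- x"]) (simp_all add: carrier_mpoly_ring)
  qed (simp_all add: carrier_mpoly_ring monomial_ideal_add ac_simps)
  show "comm_monoid (mpoly_ring n :: 'k mpoly ring)"
    by (rule comm_monoidI) (simp_all add: carrier_mpoly_ring monomial_ideal_mult[OF upset_exponents] ac_simps)
qed (simp add: ring_distribs)

lemma a_inv_mpoly_ring:
  assumes "p \<in> carrier (mpoly_ring n)"
  shows "\<ominus>\<^bsub>mpoly_ring n\<^esub> p = - p"
proof -
  interpret cring "mpoly_ring n" by (rule cring_mpoly_ring)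
  show ?thesis
    using assms by (intro minus_equality) (simp_all add: carrier_mpoly_ring)
qed

lemma a_minus_mpoly_ring:
  "q \<in> carrier (mpoly_ring n) \<Longrightarrow> p \<ominus>\<^bsub>mpoly_ring n\<^esub> q = p - q"
  by (simp add: a_minus_def a_inv_mpoly_ring)

lemma ideal_monomial_ideal:
  assumes "upset n M"
  shows "ideal (monomial_ideal M) (mpoly_ring n)"
proof -
  interpret cring "mpoly_ring n" by (rule cring_mpoly_ring)
  show ?thesis
  proof (rule idealI)
    show "subgroup (monomial_ideal M) (add_monoid (mpoly_ring n))"
    proof (rule add.subgroupI)
      show sub: "monomial_ideal M \<subseteq> carrier (mpoly_ring n)"
        using upset_subset[OF assms] by (auto simp: carrier_mpoly_ring monomial_ideal_def)
      show "monomial_ideal M \<noteq> {}"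
        using monomial_ideal_zero by blast
      show "\<ominus>\<^bsub>mpoly_ring n\<^esub> a \<in> monomial_ideal M" if "a \<in> monomial_ideal M" for a
        using that sub by (subst a_inv_mpoly_ring) auto
    qed (simp add: monomial_ideal_add)
  qed (auto simp: carrier_mpoly_ring monomial_ideal_mult[OF assms] mult.commute ring_axioms)
qed

lemma monomial_mult: "monomial m * monomial u = monomial (m + u)"
  by (simp add: monomial_def mult_single)

lemma monomial_zero [simp]: "monomial 0 = 1"
  by (simp add: monomial_def)

lemma lookup_monomial_mult: "lookup (monomial u * p) (u + e) = lookup p e"
  by (simp add: lookup_mult monomial_def lookup_single when_mult)

lemma keys_monomial_mult: "keys (monomial u * p) = (+) u ` keys p"
proof
  show "keys (monomial u * p) \<subseteq> (+) u ` keys p"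
    using keys_mult[of "monomial u" p] by (auto simp: monomial_def)
  show "(+) u ` keys p \<subseteq> keys (monomial u * p)"
    by (auto simp: in_keys_iff lookup_monomial_mult)
qed

lemma monomial_mult_mem [simp]:
  "p \<in> monomial_ideal (exponents n) \<Longrightarrow> u \<in> exponents n \<Longrightarrow> monomial u * p \<in> monomial_ideal (exponents n)"
  by (auto simp: monomial_ideal_def keys_monomial_mult)

lemma mdeg_eq_sum: "finite V \<Longrightarrow> keys m \<subseteq> V \<Longrightarrow> mdeg m = (\<Sum>v\<in>V. lookup m v)"
  unfolding mdeg_def by (rule sum.mono_neutral_left) (auto simp: in_keys_iff)

lemma mdeg_add [simp]: "mdeg (m + u) = mdeg m + mdeg u"
proof -
  have "mdeg (m + u) = (\<Sum>v\<in>keys m \<union> keys u. lookup (m + u) v)"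
    by (rule mdeg_eq_sum) (auto simp: keys_exponent_add)
  also have "\<dots> = (\<Sum>v\<in>keys m \<union> keys u. lookup m v) + (\<Sum>v\<in>keys m \<union> keys u. lookup u v)"
    by (simp add: lookup_add sum.distrib)
  finally show ?thesis
    by (simp add: mdeg_eq_sum[of "keys m \<union> keys u"])
qed

lemma homogeneous_mpoly: "homogeneous n e \<subseteq> monomial_ideal (exponents n)"
  by (auto simp: homogeneous_def carrier_mpoly_ring)

lemma homogeneous_zero [simp]: "0 \<in> homogeneous n e"
  by (auto simp: homogeneous_def carrier_mpoly_ring)

lemma homogeneous_add: "p \<in> homogeneous n e \<Longrightarrow> q \<in> homogeneous n e \<Longrightarrow> p + q \<in> homogeneous n e"
  using keys_add[of p q] by (auto simp: homogeneous_def carrier_mpoly_ring monomial_ideal_add)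

lemma homogeneous_monomial_mult:
  "p \<in> homogeneous n e \<Longrightarrow> u \<in> exponents n \<Longrightarrow> e' = e + int (mdeg u) \<Longrightarrow> monomial u * p \<in> homogeneous n e'"
  by (auto simp: homogeneous_def carrier_mpoly_ring keys_monomial_mult)

text \<open>The pair \<open>(b, g)\<close> encodes the degree \<open>b - g \<in> \<int>\<^sup>n\<close>; below, \<open>coef F X b g\<close> is the coefficient of
  \<open>x\<^sup>b / x\<^sup>g\<close> in the fraction \<open>X\<close>.\<close>

definition degree_complex :: "nat \<Rightarrow> exponent set \<Rightarrow> exponent \<Rightarrow> exponent \<Rightarrow> nat set set" where
  "degree_complex n M b g =
    {F. F \<subseteq> {1..n} \<and> keys g \<subseteq> F \<and> (\<forall>w. keys w \<subseteq> F \<longrightarrow> b + w \<notin> M)}"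

lemma abelian_group_cong:
  assumes "abelian_group G" "carrier H = carrier G" "add H = add G" "zero H = zero G"
  shows "abelian_group H"
  by (rule abelian_groupI) (use abelian_groupE[OF assms(1)] assms(2-) in auto)

section \<open>Localizations of S/J at monomials\<close>

locale monomial_quotient =
  fixes n :: nat and M :: "exponent set" and J :: "'k::field mpoly set"
  assumes upset: "upset n M" and J_eq: "J = monomial_ideal M"
begin

abbreviation "S \<equiv> mpoly_ring n :: 'k mpoly ring"
abbreviation "L \<equiv> quotient_module n J"

sublocale S: cring S by (rule cring_mpoly_ring)
sublocale J: ideal J S unfolding J_eq by (rule ideal_monomial_ideal[OF upset])

abbreviation cls :: "'k mpoly \<Rightarrow> 'k mpoly set" where "cls p \<equiv> J +>\<^bsub>S\<^esub> p"

lemma carrier_L: "carrier L = cls ` carrier S"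
  by (auto simp: quotient_module_def Let_def FactRing_def A_RCOSETS_def')

lemma add_L: "p \<in> carrier S \<Longrightarrow> q \<in> carrier S \<Longrightarrow> cls p \<oplus>\<^bsub>L\<^esub> cls q = cls (p + q)"
  using J.a_rcos_sum[of p q] by (simp add: quotient_module_def Let_def FactRing_def)

lemma smult_L: "p \<in> carrier S \<Longrightarrow> q \<in> carrier S \<Longrightarrow> p \<odot>\<^bsub>L\<^esub> cls q = cls (p * q)"
  using J.rcoset_mult_add[of p q] by (simp add: quotient_module_def Let_def FactRing_def)

lemma zero_L: "\<zero>\<^bsub>L\<^esub> = cls 0"
  using J.a_rcos_const[of 0] by (simp add: quotient_module_def Let_def FactRing_def J_eq)

lemma cls_eq_iff: "p \<in> carrier S \<Longrightarrow> q \<in> carrier S \<Longrightarrow> cls p = cls q \<longleftrightarrow> p - q \<in> J"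
  using S.quotient_eq_iff_same_a_r_cos[OF J.is_ideal, of p q] by (simp add: a_minus_mpoly_ring)

lemma module_L: "module S L"
proof (rule moduleI)
  show "cring S" by (rule cring_mpoly_ring)
  interpret Q: ring "S Quot J" by (rule J.quotient_is_ring)
  show "abelian_group L"
    by (rule abelian_group_cong[OF Q.abelian_group_axioms]) (simp_all add: quotient_module_def Let_def)
qed (auto simp: carrier_L smult_L add_L ring_distribs mult.assoc S.m_closed[simplified] S.a_closed[simplified]
    S.one_closed[simplified])

lemma monomials_I: "keys m \<subseteq> F \<Longrightarrow> monomial m \<in> monomials F"
  by (auto simp: monomials_def)

lemma monomials_mono: "F \<subseteq> G \<Longrightarrow> monomials F \<subseteq> monomials G"
  unfolding monomials_def by blast

lemma module_fractions_L:
  assumes "F \<subseteq> {1..n}"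
  shows "module_fractions S L (monomials F)"
  unfolding module_fractions_def module_fractions_axioms_def
proof (intro conjI allI impI)
  show "module S L" by (rule module_L)
  show "monomials F \<subseteq> carrier S"
    using assms by (auto simp: monomials_def carrier_mpoly_ring exponents_def)
  show "\<one>\<^bsub>S\<^esub> \<in> monomials F"
    by (auto simp: monomials_def intro!: exI[of _ 0])
  show "t \<otimes>\<^bsub>S\<^esub> u \<in> monomials F" if "t \<in> monomials F" "u \<in> monomials F" for t u
    using that by (force simp: monomials_def monomial_mult keys_exponent_add)
qed

abbreviation "C F \<equiv> cech_module n L F"

lemma cech_module_simps:
  "carrier (C F) = carrier (localization S L (monomials F))"
  "add (C F) = add (localization S L (monomials F))"
  "zero (C F) = zero (localization S L (monomials F))"
  "smult (C F) = smult (localization S L (monomials F))"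
  by (simp_all add: cech_module_def module.defs Let_def)

lemma abelian_group_C:
  assumes "F \<subseteq> {1..n}"
  shows "abelian_group (C F)"
  by (rule abelian_group_cong[OF module_fractions.abelian_group_localization[OF module_fractions_L[OF assms]]])
    (simp_all add: cech_module_simps)

text \<open>The fraction \<open>p / x^m\<close>, with a polynomial in place of its residue class and
  the exponent in place of the denominator, so that questions about fractions become questions about
  coefficients.\<close>

definition cfrac :: "nat set \<Rightarrow> 'k mpoly \<Rightarrow> exponent \<Rightarrow> ('k mpoly set \<times> 'k mpoly) set" where
  "cfrac F p m = frac S L (monomials F) (cls p) (monomial m)"

lemma monomial_carrier: "F \<subseteq> {1..n} \<Longrightarrow> keys m \<subseteq> F \<Longrightarrow> monomial m \<in> carrier S"
  by (auto simp: carrier_mpoly_ring exponents_def)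

lemma mult_carrier: "p \<in> carrier S \<Longrightarrow> q \<in> carrier S \<Longrightarrow> p * q \<in> carrier S"
  using S.m_closed by simp

lemma add_carrier: "p \<in> carrier S \<Longrightarrow> q \<in> carrier S \<Longrightarrow> p + q \<in> carrier S"
  using S.a_closed by simp

lemma cfrac_eq_iff:
  assumes "F \<subseteq> {1..n}" "p \<in> carrier S" "q \<in> carrier S" "keys m \<subseteq> F" "keys u \<subseteq> F"
  shows "cfrac F p m = cfrac F q u \<longleftrightarrow>
    (\<exists>w. keys w \<subseteq> F \<and> monomial w * (monomial u * p - monomial m * q) \<in> J)"
proof -
  interpret module_fractions S L "monomials F"
    by (rule module_fractions_L[OF assms(1)])
  have cong: "(\<exists>t\<in>monomials F. P t) \<longleftrightarrow> (\<exists>w. keys w \<subseteq> F \<and> P (monomial w))" for P :: "'k mpoly \<Rightarrow> bool"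
    by (auto simp: monomials_def)
  have *: "monomial w \<odot>\<^bsub>L\<^esub> (monomial u \<odot>\<^bsub>L\<^esub> cls p) = monomial w \<odot>\<^bsub>L\<^esub> (monomial m \<odot>\<^bsub>L\<^esub> cls q) \<longleftrightarrow>
      monomial w * (monomial u * p - monomial m * q) \<in> J" if "keys w \<subseteq> F" for w
    using assms that
    by (simp add: smult_L monomial_carrier[OF assms(1)] mult_carrier cls_eq_iff algebra_simps)
  show ?thesis
    unfolding cfrac_def using assms
    by (subst frac_eq_iff) (auto simp: carrier_L cong * cong: conj_cong intro: monomials_I)
qed

lemma cfrac_add:
  assumes "F \<subseteq> {1..n}" "p \<in> carrier S" "q \<in> carrier S" "keys m \<subseteq> F" "keys u \<subseteq> F"
  shows "cfrac F p m \<oplus>\<^bsub>C F\<^esub> cfrac F q u = cfrac F (monomial u * p + monomial m * q) (m + u)"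
proof -
  interpret module_fractions S L "monomials F"
    by (rule module_fractions_L[OF assms(1)])
  show ?thesis
    unfolding cfrac_def cech_module_simps using assms
    by (subst frac_add)
      (auto simp: carrier_L monomials_def smult_L monomial_carrier[OF assms(1)] mult_carrier add_L monomial_mult)
qed

lemma cfrac_smult:
  assumes "F \<subseteq> {1..n}" "r \<in> carrier S" "p \<in> carrier S" "keys m \<subseteq> F"
  shows "r \<odot>\<^bsub>C F\<^esub> cfrac F p m = cfrac F (r * p) m"
proof -
  interpret module_fractions S L "monomials F"
    by (rule module_fractions_L[OF assms(1)])
  show ?thesis
    unfolding cfrac_def cech_module_simps using assms
    by (subst frac_smult) (auto simp: carrier_L monomials_def smult_L)
qed

lemma zero_C:
  assumes "F \<subseteq> {1..n}"
  shows "\<zero>\<^bsub>C F\<^esub> = cfrac F 0 0"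
proof -
  interpret module_fractions S L "monomials F"
    by (rule module_fractions_L[OF assms(1)])
  show ?thesis
    unfolding cfrac_def cech_module_simps using frac_zero[of 1] T_one by (simp add: zero_L)
qed

lemma carrier_C:
  assumes "F \<subseteq> {1..n}"
  shows "carrier (C F) = {cfrac F p m |p m. p \<in> carrier S \<and> keys m \<subseteq> F}"
proof -
  interpret module_fractions S L "monomials F"
    by (rule module_fractions_L[OF assms(1)])
  show ?thesis
    unfolding cfrac_def cech_module_simps carrier_localization carrier_L
    by (auto simp: monomials_def)
qed

lemma degree_part_C:
  "degree_part (C F) j = {cfrac F p m |p m. keys m \<subseteq> F \<and> p \<in> homogeneous n (j + int (mdeg m))}"
  unfolding cech_module_def Let_def module.extend_def graded_module.fields_def cfrac_def
  by (auto simp: quotient_module_def Let_def)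

lemma degree_part_subset: "F \<subseteq> {1..n} \<Longrightarrow> degree_part (C F) j \<subseteq> carrier (C F)"
  using homogeneous_mpoly by (fastforce simp: degree_part_C carrier_C carrier_mpoly_ring)

lemma localization_map_cfrac:
  assumes "F \<subseteq> G" "G \<subseteq> {1..n}" "p \<in> carrier S" "keys m \<subseteq> F"
  shows "localization_map S L (monomials G) (cfrac F p m) = cfrac G p m"
proof -
  interpret module_fractions S L "monomials F"
    using assms by (intro module_fractions_L) auto
  show ?thesis
    unfolding cfrac_def
    by (rule localization_map_frac)
      (use assms in \<open>auto simp: carrier_L intro!: module_fractions_L monomials_I monomials_mono\<close>)
qed

end


section \<open>Coefficients in the fine grading\<close>

text \<open>A degree in Z^n is a difference of exponents in many ways; disjoint supports single out
  its positive and negative part, so that each degree is counted once.\<close>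

definition reduced :: "exponent \<Rightarrow> exponent \<Rightarrow> bool" where
  "reduced b g \<longleftrightarrow> keys b \<inter> keys g = {}"

text \<open>Subtraction of exponents is truncated at 0, so \<open>e - m\<close> and
  \<open>m - e\<close> are the positive and the negative part of the integral difference.\<close>

lemma reducedE:
  assumes "reduced b g" "b + m = g + e"
  shows "b = e - m" "g = m - e"
proof -
  have *: "lookup b v = lookup e v - lookup m v \<and> lookup g v = lookup m v - lookup e v" for v
  proof -
    have "lookup b v + lookup m v = lookup g v + lookup e v"
      using assms(2) by (metis lookup_add)
    moreover have "lookup b v = 0 \<or> lookup g v = 0"
      using assms(1) by (auto simp: reduced_def in_keys_iff)
    ultimately show ?thesis by auto
  qed
  show "b = e - m" "g = m - e"
    using * by (auto intro!: poly_mapping_eqI simp: lookup_minus)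
qed

lemma reduced_diff: "reduced (e - m) (m - e)"
  by (auto simp: reduced_def in_keys_iff lookup_minus)

lemma diff_add_exponent: "(m - e) + e = (e - m) + (m :: exponent)"
  by (rule poly_mapping_eqI) (simp add: lookup_add lookup_minus)

lemma keys_diff_exponent: "keys (m - e :: exponent) \<subseteq> keys m"
  by (auto simp: in_keys_iff lookup_minus)

lemma lookup_sign_mult: "lookup ((-1) ^ k * p :: 'k::field mpoly) e = (-1) ^ k * lookup p e"
  by (cases "even k") auto

context monomial_quotient
begin

abbreviation "K b g \<equiv> degree_complex n M b g"

lemma K_subset: "F \<in> K b g \<Longrightarrow> F \<subseteq> {1..n}"
  by (simp add: degree_complex_def)

text \<open>The relevant exponent \<open>b + m - g\<close> of \<open>p\<close> may leave the natural
  numbers, so \<open>p\<close> is multiplied by \<open>x^g\<close> and read at \<open>b + m\<close>.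
  Outside the degree complex the value is set to 0: there the coefficient may depend on the
  representative, or \<open>x^g\<close> has variables that are not inverted.\<close>

definition coef :: "nat set \<Rightarrow> ('k mpoly set \<times> 'k mpoly) set \<Rightarrow> exponent \<Rightarrow> exponent \<Rightarrow> 'k" where
  "coef F X b g = (if F \<in> K b g then
     (case SOME (p, m). p \<in> carrier S \<and> keys m \<subseteq> F \<and> X = cfrac F p m of
       (p, m) \<Rightarrow> lookup (monomial g * p) (b + m)) else 0)"

text \<open>A visible exponent of \<open>r\<close>, increased by \<open>g\<close>, would lie in
  \<open>M\<close> and equal \<open>b + w\<close> with \<open>w\<close> on \<open>F\<close>, which
  membership in the degree complex excludes. This is what makes coefficients independent of
  representatives.\<close>

lemma lookup_ideal_zero:
  assumes "r \<in> J" "F \<in> K b g" "keys w \<subseteq> F"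
  shows "lookup (monomial g * r) (b + w) = 0"
proof (rule ccontr)
  assume "lookup (monomial g * r) (b + w) \<noteq> 0"
  then obtain e where e: "e \<in> keys r" "b + w = g + e"
    by (auto simp: keys_monomial_mult simp flip: in_keys_iff)
  have "e + g \<in> M"
    using e(1) assms by (intro upsetD[OF upset])
      (auto simp: J_eq monomial_ideal_def exponents_def degree_complex_def)
  then show False
    using assms(2,3) e(2) by (auto simp: degree_complex_def add.commute)
qed

lemma coef_well_defined:
  assumes "F \<in> K b g" "p \<in> carrier S" "q \<in> carrier S" "keys m \<subseteq> F" "keys u \<subseteq> F"
    and "cfrac F p m = cfrac F q u"
  shows "lookup (monomial g * p) (b + m) = lookup (monomial g * q) (b + u)"
proof -
  obtain w where w: "keys w \<subseteq> F" "monomial w * (monomial u * p - monomial m * q) \<in> J"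
    using cfrac_eq_iff[OF K_subset[OF assms(1)] assms(2-5)] assms(6) by blast
  let ?r = "monomial w * (monomial u * p - monomial m * q)"
  have eq: "monomial g * ?r =
      monomial (w + u) * (monomial g * p) - monomial (w + m) * (monomial g * q)"
    by (simp add: algebra_simps flip: monomial_mult)
  have "lookup (monomial g * ?r) (b + (m + u + w)) = 0"
    using w assms by (intro lookup_ideal_zero) (auto simp: keys_exponent_add)
  moreover have "b + (m + u + w) = (w + u) + (b + m)" "b + (m + u + w) = (w + m) + (b + u)"
    by (simp_all add: add_ac)
  ultimately show ?thesis
    unfolding eq lookup_minus by (metis lookup_monomial_mult right_minus_eq)
qed

lemma coef_cfrac:
  assumes "p \<in> carrier S" "keys m \<subseteq> F"
  shows "coef F (cfrac F p m) b g = (if F \<in> K b g then lookup (monomial g * p) (b + m) else 0)"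
proof (cases "F \<in> K b g")
  case True
  let ?P = "\<lambda>z. case z of (q, u) \<Rightarrow> q \<in> carrier S \<and> keys u \<subseteq> F \<and> cfrac F p m = cfrac F q u"
  obtain q u where qu: "(SOME z. ?P z) = (q, u)" by fastforce
  have "?P (SOME z. ?P z)"
    by (rule someI[of ?P "(p, m)"]) (use assms in auto)
  then have "lookup (monomial g * p) (b + m) = lookup (monomial g * q) (b + u)"
    unfolding qu using True assms by (intro coef_well_defined) auto
  then show ?thesis
    using True by (simp add: coef_def qu)
qed (simp add: coef_def)

lemma coef_outside: "F \<notin> K b g \<Longrightarrow> coef F X b g = 0"
  by (simp add: coef_def)

lemma carrier_C_cases:
  assumes "X \<in> carrier (C F)" "F \<subseteq> {1..n}"
  obtains p m where "X = cfrac F p m" "p \<in> carrier S" "keys m \<subseteq> F"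
  using assms by (auto simp: carrier_C)

lemma coef_add:
  assumes F: "F \<subseteq> {1..n}" and X: "X \<in> carrier (C F)" and Y: "Y \<in> carrier (C F)"
  shows "coef F (X \<oplus>\<^bsub>C F\<^esub> Y) b g = coef F X b g + coef F Y b g"
proof (cases "F \<in> K b g")
  case True
  obtain p m where p: "X = cfrac F p m" "p \<in> carrier S" "keys m \<subseteq> F"
    using X F by (rule carrier_C_cases)
  obtain q u where q: "Y = cfrac F q u" "q \<in> carrier S" "keys u \<subseteq> F"
    using Y F by (rule carrier_C_cases)
  have "monomial g * (monomial u * p + monomial m * q) = monomial u * (monomial g * p) + monomial m * (monomial g * q)"
    by (simp add: algebra_simps)
  moreover have "b + (m + u) = u + (b + m)" "b + (m + u) = m + (b + u)"
    by (simp_all add: ac_simps)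
  ultimately have "lookup (monomial g * (monomial u * p + monomial m * q)) (b + (m + u)) =
      lookup (monomial g * p) (b + m) + lookup (monomial g * q) (b + u)"
    by (metis lookup_add lookup_monomial_mult)
  then show ?thesis
    using p q F True
    by (simp add: cfrac_add coef_cfrac keys_exponent_add add_carrier mult_carrier monomial_carrier[OF F])
qed (simp add: coef_outside)

lemma zero_mem_carrier: "0 \<in> carrier S"
  by (simp add: carrier_mpoly_ring)

lemma sign_mem_carrier: "(-1) ^ k \<in> carrier S"
  by (cases "even k") (simp_all add: carrier_mpoly_ring)

lemma coef_zero: "F \<subseteq> {1..n} \<Longrightarrow> coef F \<zero>\<^bsub>C F\<^esub> b g = 0"
  by (simp add: zero_C coef_cfrac zero_mem_carrier)

lemma coef_sign:
  assumes F: "F \<subseteq> {1..n}" and X: "X \<in> carrier (C F)"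
  shows "coef F ((-1) ^ k \<odot>\<^bsub>C F\<^esub> X) b g = (-1) ^ k * coef F X b g"
proof -
  obtain p m where p: "X = cfrac F p m" "p \<in> carrier S" "keys m \<subseteq> F"
    using X F by (rule carrier_C_cases)
  have "lookup (monomial g * ((-1) ^ k * p)) e = (-1) ^ k * lookup (monomial g * p) e" for e
    by (cases "even k") auto
  then show ?thesis
    using p F by (simp add: cfrac_smult sign_mem_carrier coef_cfrac mult_carrier lookup_sign_mult)
qed

text \<open>After clearing denominators, an exponent \<open>e\<close> of the difference either is
  seen by the coefficient in its own degree, or this degree lies outside the complex and then a
  monomial on \<open>F\<close> pushes \<open>e\<close> into \<open>M\<close>.\<close>

lemma coef_eqI:
  assumes F: "F \<subseteq> {1..n}" and X: "X \<in> carrier (C F)" and Y: "Y \<in> carrier (C F)"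
    and eq: "\<And>b g. reduced b g \<Longrightarrow> coef F X b g = coef F Y b g"
  shows "X = Y"
proof -
  obtain p m where p: "X = cfrac F p m" "p \<in> carrier S" "keys m \<subseteq> F"
    using X F by (rule carrier_C_cases)
  obtain q u where q: "Y = cfrac F q u" "q \<in> carrier S" "keys u \<subseteq> F"
    using Y F by (rule carrier_C_cases)
  define r where "r = monomial u * p - monomial m * q"
  have ex: "\<exists>w. keys w \<subseteq> F \<and> e + w \<in> M" if e: "e \<in> keys r" for e
  proof -
    \<comment> \<open>Positive and negative part of \<open>e - (m + u)\<close>, the degree of
      \<open>x^e\<close> once the common denominator is restored.\<close>
    define b g where "b = e - (m + u)" and "g = (m + u) - e"
    have red: "reduced b g"
      unfolding b_def g_def by (rule reduced_diff)
    have ge: "g + e = b + (m + u)"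
      unfolding b_def g_def by (rule diff_add_exponent)
    have g: "keys g \<subseteq> F"
      unfolding g_def using keys_diff_exponent[of "m + u" e] p q by (auto simp: keys_exponent_add)
    have "lookup r e = lookup (monomial g * r) (b + (m + u))"
      unfolding ge[symmetric] lookup_monomial_mult ..
    also have "\<dots> = lookup (monomial u * (monomial g * p)) (u + (b + m)) -
        lookup (monomial m * (monomial g * q)) (m + (b + u))"
      unfolding r_def by (simp add: algebra_simps lookup_minus)
    finally have r: "lookup r e = lookup (monomial g * p) (b + m) - lookup (monomial g * q) (b + u)"
      unfolding lookup_monomial_mult .
    have "F \<notin> K b g"
    proof
      assume "F \<in> K b g"
      then have "lookup r e = 0"
        using eq[OF red] p q unfolding r by (simp add: coef_cfrac)
      then show False
        using e by (simp add: in_keys_iff)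
    qed
    then obtain w where w: "keys w \<subseteq> F" "b + w \<in> M"
      using F g by (auto simp: degree_complex_def)
    have "b + w + (m + u) \<in> M"
      using p q F by (intro upsetD[OF upset w(2)]) (auto simp: exponents_def keys_exponent_add)
    then have "e + (g + w) \<in> M"
      using ge by (metis add.assoc add.commute)
    then show ?thesis
      using w(1) g by (intro exI[of _ "g + w"]) (auto simp: keys_exponent_add)
  qed
  then obtain w where w: "\<And>e. e \<in> keys r \<Longrightarrow> keys (w e) \<subseteq> F \<and> e + w e \<in> M"
    by metis
  \<comment> \<open>The sum of the individual multipliers works for all exponents of
    \<open>r\<close> at once, as \<open>M\<close> is an upset.\<close>
  define W where "W = (\<Sum>e\<in>keys r. w e)"
  have keys_sum: "keys (\<Sum>e\<in>A. w e) \<subseteq> F" if "A \<subseteq> keys r" for A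
    using finite_subset[OF that finite_keys] that
    by (induction A rule: finite_induct) (use w in \<open>auto simp: keys_exponent_add\<close>)
  have "W + e \<in> M" if "e \<in> keys r" for e
  proof -
    have "W + e = (e + w e) + (\<Sum>x\<in>keys r - {e}. w x)"
      unfolding W_def using that by (subst sum.remove[of _ e]) (auto simp: ac_simps)
    then show ?thesis
      using w[OF that] keys_sum[of "keys r - {e}"] F
      by (metis (no_types, lifting) Diff_subset exponents_def mem_Collect_eq subset_trans upset upsetD)
  qed
  then have "monomial W * r \<in> J"
    by (auto simp: J_eq monomial_ideal_def keys_monomial_mult)
  then show ?thesis
    using p q F keys_sum[of "keys r"] by (auto simp: cfrac_eq_iff r_def W_def)
qed

text \<open>The critical case is \<open>G\<close> in the complex and \<open>F\<close> not. As
  \<open>F \<subseteq> G\<close>, this means that \<open>g\<close> is not supported on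
  \<open>F\<close>; but a nonzero coefficient of \<open>p / x^m\<close> forces
  \<open>g = m - e\<close>, whose support is inside that of \<open>m\<close> and hence inside
  \<open>F\<close>.\<close>

lemma coef_localization_map:
  assumes FG: "F \<subseteq> G" and G: "G \<subseteq> {1..n}" and X: "X \<in> carrier (C F)" and red: "reduced b g"
  shows "coef G (localization_map S L (monomials G) X) b g = (if G \<in> K b g then coef F X b g else 0)"
proof (cases "G \<in> K b g")
  case True
  have F: "F \<subseteq> {1..n}" using assms by blast
  obtain p m where p: "X = cfrac F p m" "p \<in> carrier S" "keys m \<subseteq> F"
    using X F by (rule carrier_C_cases)
  have "lookup (monomial g * p) (b + m) = 0" if "F \<notin> K b g"
  proof (rule ccontr)
    assume "lookup (monomial g * p) (b + m) \<noteq> 0"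
    then obtain e where e: "b + m = g + e"
      by (auto simp: keys_monomial_mult simp flip: in_keys_iff)
    have "keys g \<subseteq> keys m"
      using reducedE(2)[OF red e] keys_diff_exponent by metis
    then show False
      using that True FG F p(3) by (auto simp: degree_complex_def)
  qed
  then show ?thesis
    using p FG G True by (auto simp: localization_map_cfrac coef_cfrac)
qed (simp add: coef_outside)

lemma coef_finsum:
  assumes G: "G \<subseteq> {1..n}" and "finite A" "\<And>v. v \<in> A \<Longrightarrow> f v \<in> carrier (C G)"
  shows "coef G (\<Oplus>\<^bsub>C G\<^esub> v\<in>A. f v) b g = (\<Sum>v\<in>A. coef G (f v) b g)"
proof -
  interpret abelian_group "C G" by (rule abelian_group_C[OF G])
  show ?thesis
    using assms(2,3)
    by (induction A rule: finite_induct) (simp_all add: coef_zero[OF G] coef_add[OF G] finsum_closed Pi_iff)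
qed

section \<open>Coefficients and the total grading\<close>

lemma degree_part_cases:
  assumes "X \<in> degree_part (C F) j"
  obtains p m where "X = cfrac F p m" "keys m \<subseteq> F" "p \<in> homogeneous n (j + int (mdeg m))"
  using assms by (auto simp: degree_part_C)

lemma homogeneous_carrier: "p \<in> homogeneous n e \<Longrightarrow> p \<in> carrier S"
  by (simp add: homogeneous_def)

lemma degree_part_add:
  assumes F: "F \<subseteq> {1..n}" and X: "X \<in> degree_part (C F) j" and Y: "Y \<in> degree_part (C F) j"
  shows "X \<oplus>\<^bsub>C F\<^esub> Y \<in> degree_part (C F) j"
proof -
  obtain p m where p: "X = cfrac F p m" "keys m \<subseteq> F" "p \<in> homogeneous n (j + int (mdeg m))"
    using X by (rule degree_part_cases)
  obtain q u where q: "Y = cfrac F q u" "keys u \<subseteq> F" "q \<in> homogeneous n (j + int (mdeg u))"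
    using Y by (rule degree_part_cases)
  have "monomial u * p + monomial m * q \<in> homogeneous n (j + int (mdeg (m + u)))"
    by (intro homogeneous_add homogeneous_monomial_mult[OF p(3)] homogeneous_monomial_mult[OF q(3)])
      (use p q F in \<open>auto simp: exponents_def\<close>)
  then show ?thesis
    using p q F unfolding degree_part_C
    by (auto simp: cfrac_add homogeneous_carrier keys_exponent_add
      intro!: exI[of _ "monomial u * p + monomial m * q"] exI[of _ "m + u"])
qed

lemma degree_part_zero: "F \<subseteq> {1..n} \<Longrightarrow> \<zero>\<^bsub>C F\<^esub> \<in> degree_part (C F) j"
  unfolding degree_part_C zero_C by (auto intro!: exI[of _ 0])

lemma degree_part_sign:
  assumes F: "F \<subseteq> {1..n}" and X: "X \<in> degree_part (C F) j"
  shows "(-1) ^ k \<odot>\<^bsub>C F\<^esub> X \<in> degree_part (C F) j"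
proof -
  obtain p m where p: "X = cfrac F p m" "keys m \<subseteq> F" "p \<in> homogeneous n (j + int (mdeg m))"
    using X by (rule degree_part_cases)
  have "(-1) ^ k * p \<in> homogeneous n (j + int (mdeg m))"
    using p(3) mult_carrier[OF sign_mem_carrier homogeneous_carrier[OF p(3)]]
    by (auto simp: homogeneous_def in_keys_iff lookup_sign_mult)
  then show ?thesis
    using p F unfolding degree_part_C by (auto simp: cfrac_smult sign_mem_carrier homogeneous_carrier)
qed

lemma degree_part_localization_map:
  assumes "F \<subseteq> G" "G \<subseteq> {1..n}" "X \<in> degree_part (C F) j"
  shows "localization_map S L (monomials G) X \<in> degree_part (C G) j"
proof -
  obtain p m where p: "X = cfrac F p m" "keys m \<subseteq> F" "p \<in> homogeneous n (j + int (mdeg m))"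
    using assms(3) by (rule degree_part_cases)
  then show ?thesis
    using assms unfolding degree_part_C by (auto simp: localization_map_cfrac homogeneous_carrier)
qed

lemma degree_part_finsum:
  assumes G: "G \<subseteq> {1..n}" and "finite A" "\<And>v. v \<in> A \<Longrightarrow> f v \<in> degree_part (C G) j"
  shows "(\<Oplus>\<^bsub>C G\<^esub> v\<in>A. f v) \<in> degree_part (C G) j"
proof -
  interpret abelian_group "C G" by (rule abelian_group_C[OF G])
  have sub: "X \<in> degree_part (C G) j \<Longrightarrow> X \<in> carrier (C G)" for X
    using degree_part_subset[OF G] by blast
  show ?thesis
    using assms(2,3)
    by (induction A rule: finite_induct) (simp_all add: degree_part_zero[OF G] degree_part_add[OF G] sub Pi_iff)
qed

lemma coef_degree:
  assumes X: "X \<in> degree_part (C F) j" and "coef F X b g \<noteq> 0"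
  shows "int (mdeg b) - int (mdeg g) = j" "b \<in> exponents n"
proof -
  obtain p m where p: "X = cfrac F p m" "keys m \<subseteq> F" "p \<in> homogeneous n (j + int (mdeg m))"
    using X by (rule degree_part_cases)
  have "F \<in> K b g" "lookup (monomial g * p) (b + m) \<noteq> 0"
    using assms(2) p by (auto simp: coef_cfrac homogeneous_carrier split: if_splits)
  then obtain e where e: "e \<in> keys p" "b + m = g + e" and F: "F \<subseteq> {1..n}" "keys g \<subseteq> F"
    by (auto simp: keys_monomial_mult degree_complex_def simp flip: in_keys_iff)
  have "mdeg b + mdeg m = mdeg g + mdeg e"
    using arg_cong[OF e(2), of mdeg] by simp
  then show "int (mdeg b) - int (mdeg g) = j"
    using p(3) e(1) by (auto simp: homogeneous_def)
  have "b + m \<in> exponents n"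
    unfolding e(2) using F e(1) subsetD[OF homogeneous_mpoly p(3)]
    by (auto simp: exponents_def monomial_ideal_def keys_exponent_add)
  then show "b \<in> exponents n" by simp
qed

text \<open>The degrees that occur are those of \<open>e - m\<close> for \<open>e\<close> in
  \<open>keys p\<close>. Finiteness later allows preimages chosen in separate degrees to be
  combined.\<close>

lemma finite_coef_support:
  assumes F: "F \<subseteq> {1..n}" and X: "X \<in> carrier (C F)"
  shows "finite {(b, g). reduced b g \<and> coef F X b g \<noteq> 0}"
proof -
  obtain p m where p: "X = cfrac F p m" "p \<in> carrier S" "keys m \<subseteq> F"
    using X F by (rule carrier_C_cases)
  have "(b, g) \<in> (\<lambda>e. (e - m, m - e)) ` keys p" if "reduced b g" "coef F X b g \<noteq> 0" for b g
  proof -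
    have "lookup (monomial g * p) (b + m) \<noteq> 0"
      using that p by (auto simp: coef_cfrac split: if_splits)
    then obtain e where e: "e \<in> keys p" "b + m = g + e"
      by (auto simp: keys_monomial_mult simp flip: in_keys_iff)
    then show ?thesis
      using reducedE[OF that(1) e(2)] by auto
  qed
  then show ?thesis
    by (intro finite_subset[OF _ finite_imageI[OF finite_keys]]) auto
qed

text \<open>Counterpart to \<open>coef_eqI\<close>: coefficients can be prescribed on finitely many
  degrees by adding up the fractions \<open>f b g x^b / x^g\<close>. Outside the complex nothing can
  be prescribed, hence the condition on \<open>F\<close> in the result.\<close>

lemma lift_coef:
  assumes F: "F \<subseteq> {1..n}" and "finite D"
    and D: "\<And>b g. (b, g) \<in> D \<Longrightarrow> reduced b g \<and> b \<in> exponents n \<and> int (mdeg b) - int (mdeg g) = j"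
  shows "\<exists>X\<in>degree_part (C F) j. \<forall>b g. reduced b g \<longrightarrow>
    coef F X b g = (if (b, g) \<in> D \<and> F \<in> K b g then f b g else 0)"
  using assms(2) D
proof (induction D rule: finite_induct)
  case empty
  then show ?case
    using degree_part_zero[OF F] coef_zero[OF F] by auto
next
  case (insert z D)
  obtain b g where z: "z = (b, g)" by fastforce
  obtain X where X: "X \<in> degree_part (C F) j" "\<And>b g. reduced b g \<Longrightarrow>
      coef F X b g = (if (b, g) \<in> D \<and> F \<in> K b g then f b g else 0)"
    using insert by auto
  have z': "reduced b g" "b \<in> exponents n" "int (mdeg b) - int (mdeg g) = j"
    using insert.prems[of b g] z by auto
  show ?case
  proof (cases "F \<in> K b g")
    case False
    then show ?thesis
      using X z by (intro bexI[of _ X]) auto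
  next
    case True
    let ?Y = "cfrac F (Poly_Mapping.single b (f b g)) g"
    have keys: "keys g \<subseteq> F"
      using True by (simp add: degree_complex_def)
    have car: "Poly_Mapping.single b (f b g) \<in> homogeneous n (j + int (mdeg g))"
      using z' by (auto simp: homogeneous_def carrier_mpoly_ring monomial_ideal_def)
    then have Y: "?Y \<in> degree_part (C F) j"
      using keys unfolding degree_part_C by blast
    have coefY: "coef F ?Y b' g' = (if b' = b \<and> g' = g then f b g else 0)" if "reduced b' g'" for b' g'
    proof (cases "F \<in> K b' g'")
      case True
      \<comment> \<open>Equality of the two sums means that the degrees agree, and reduced pairs of
        the same degree coincide.\<close>
      have "g' + b = b' + g \<longleftrightarrow> b' = b \<and> g' = g"
        using reducedE[OF that, of g b] reducedE[OF z'(1), of g b] by (auto simp: add.commute)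
      then show ?thesis
        using True keys homogeneous_carrier[OF car]
        by (auto simp: coef_cfrac monomial_def mult_single lookup_single when_def)
    next
      case False
      then show ?thesis using \<open>F \<in> K b g\<close> by (auto simp: coef_outside)
    qed
    have "coef F (X \<oplus>\<^bsub>C F\<^esub> ?Y) b' g' = (if (b', g') \<in> insert z D \<and> F \<in> K b' g' then f b' g' else 0)"
      if "reduced b' g'" for b' g'
      using X Y degree_part_subset[OF F] coefY[OF that] that True insert.hyps(2) z
      by (subst coef_add[OF F]) auto
    then show ?thesis
      using degree_part_add[OF F X(1) Y] by blast
  qed
qed

end


section \<open>Reduction to combinatorial complexes\<close>

definition pos_sign :: "nat \<Rightarrow> nat set \<Rightarrow> 'k::field" where
  "pos_sign v G = (-1) ^ card {w \<in> G. w < v}"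

text \<open>A degree complex contains only supersets of \<open>keys g\<close>, so it need not be
  closed under subsets; a missing \<open>G - {v}\<close> contributes 0, as in a relative cochain
  complex.\<close>

definition cdiff :: "nat set set \<Rightarrow> (nat set \<Rightarrow> 'k::field) \<Rightarrow> nat set \<Rightarrow> 'k" where
  "cdiff K c G = (\<Sum>v\<in>G. pos_sign v G * (if G - {v} \<in> K then c (G - {v}) else 0))"

definition is_cocycle :: "nat set set \<Rightarrow> nat \<Rightarrow> (nat set \<Rightarrow> 'k::field) \<Rightarrow> bool" where
  "is_cocycle K i c \<longleftrightarrow> (\<forall>G\<in>K. card G = Suc i \<longrightarrow> cdiff K c G = 0)"

text \<open>For \<open>i = 0\<close> the sum over the empty set makes every coboundary vanish on
  \<open>{}\<close>, in agreement with the special case in \<open>cech_coboundaries\<close>.\<close>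

definition is_coboundary :: "nat set set \<Rightarrow> nat \<Rightarrow> (nat set \<Rightarrow> 'k::field) \<Rightarrow> bool" where
  "is_coboundary K i c \<longleftrightarrow> (\<exists>b. \<forall>F\<in>K. card F = i \<longrightarrow> c F = cdiff K b F)"

lemma cdiff_empty [simp]: "cdiff K c {} = 0"
  by (simp add: cdiff_def)

lemma cdiff_zero [simp]: "cdiff K (\<lambda>F. 0) G = 0"
  by (simp add: cdiff_def)

lemma cdiff_linear: "cdiff K (\<lambda>F. c F + r * c' F) G = cdiff K c G + r * cdiff K c' G"
  unfolding cdiff_def by (simp add: sum.distrib sum_distrib_left algebra_simps if_distrib cong: if_cong)
    (simp add: sum.distrib[symmetric], rule sum.cong, auto simp: algebra_simps)

lemma pos_sign_insert:
  assumes "finite G" "x \<notin> G"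
  shows "pos_sign u (insert x G) = (if x < u then - pos_sign u G else (pos_sign u G :: 'k::field))"
proof -
  have "{w \<in> insert x G. w < u} = (if x < u then insert x {w \<in> G. w < u} else {w \<in> G. w < u})"
    by auto
  then show ?thesis
    using assms by (simp add: pos_sign_def)
qed

lemma pos_sign_square [simp]: "pos_sign u G * (pos_sign u G * x) = (x :: 'k::field)"
  by (cases "even (card {w \<in> G. w < u})") (simp_all add: pos_sign_def)

text \<open>A complex that is stable under toggling \<open>v\<close> is a cone; the contracting homotopy sends \<open>c\<close> to
  \<open>F \<mapsto> \<plusminus> c (F \<union> {v})\<close> for \<open>v \<notin> F\<close>.\<close>

lemma cone_cocycle_is_coboundary:
  fixes c :: "nat set \<Rightarrow> 'k::field"
  assumes fin: "\<And>F. F \<in> K \<Longrightarrow> finite F"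
    and cone: "\<And>F. v \<notin> F \<Longrightarrow> F \<in> K \<longleftrightarrow> insert v F \<in> K"
    and cocycle: "is_cocycle K i c"
  shows "is_coboundary K i c"
proof -
  define b where "b F = (if v \<in> F then 0 else pos_sign v F * c (insert v F))" for F
  have "c G = cdiff K b G" if G: "G \<in> K" "card G = i" for G
  proof (cases "v \<in> G")
    case True
    have G': "insert v (G - {v}) = G" using True by auto
    have fG: "finite (G - {v})" using fin[OF G(1)] by simp
    have inK: "G - {v} \<in> K" using cone[of "G - {v}"] G G' by simp
    have sgn: "pos_sign v G = (pos_sign v (G - {v}) :: 'k)"
      using pos_sign_insert[OF fG, of v v] G' by auto
    \<comment> \<open>The summands with \<open>u \<noteq> v\<close> vanish because \<open>b\<close>
      is 0 on sets containing \<open>v\<close>.\<close>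
    have "cdiff K b G = (\<Sum>u\<in>{v}. pos_sign u G * (if G - {u} \<in> K then b (G - {u}) else 0))"
      unfolding cdiff_def using fin[OF G(1)] True by (intro sum.mono_neutral_right) (auto simp: b_def)
    also have "\<dots> = c G"
      using inK G' by (simp add: b_def sgn)
    finally show ?thesis by simp
  next
    case False
    have fG: "finite G" using fin[OF G(1)] .
    have sgn: "pos_sign u G * pos_sign v (G - {u}) = (- pos_sign v G * pos_sign u (insert v G) :: 'k)"
      if u: "u \<in> G" for u
    proof -
      have "u \<noteq> v" using u False by auto
      have "pos_sign v G = (if u < v then - pos_sign v (G - {u}) else (pos_sign v (G - {u}) :: 'k))"
        using pos_sign_insert[of "G - {u}" u v] fG u by (simp add: insert_absorb)
      then show ?thesis
        using pos_sign_insert[OF fG False, of u, where 'k = 'k] \<open>u \<noteq> v\<close> by auto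
    qed
    have vK: "insert v G \<in> K" "card (insert v G) = Suc i"
      using cone[OF False] G fG False by auto
    \<comment> \<open>In the cocycle condition on \<open>insert v G\<close> the summand of
      \<open>v\<close> is \<open>c G\<close> up to sign; the others are, up to the factor
      \<open>- pos_sign v G\<close>, the summands of \<open>cdiff K b G\<close>.\<close>
    have "0 = cdiff K c (insert v G)"
      using cocycle vK by (simp add: is_cocycle_def)
    also have "\<dots> = pos_sign v G * c G +
        (\<Sum>u\<in>G. pos_sign u (insert v G) * (if insert v G - {u} \<in> K then c (insert v G - {u}) else 0))"
      unfolding cdiff_def using fG False G pos_sign_insert[OF fG False, of v, where 'k = 'k]
      by (simp add: Diff_insert_absorb)
    finally have 0: "(\<Sum>u\<in>G. pos_sign u (insert v G) * (if insert v G - {u} \<in> K then c (insert v G - {u}) else 0))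
        = - pos_sign v G * c G"
      by (simp add: eq_neg_iff_add_eq_0 add.commute)
    have "cdiff K b G = (\<Sum>u\<in>G. - pos_sign v G *
        (pos_sign u (insert v G) * (if insert v G - {u} \<in> K then c (insert v G - {u}) else 0)))"
      unfolding cdiff_def
    proof (rule sum.cong[OF refl])
      fix u assume u: "u \<in> G"
      have ins: "insert v (G - {u}) = insert v G - {u}" using u False by auto
      have "G - {u} \<in> K \<longleftrightarrow> insert v G - {u} \<in> K"
        using cone[of "G - {u}"] False ins by auto
      then show "pos_sign u G * (if G - {u} \<in> K then b (G - {u}) else 0) =
          - pos_sign v G * (pos_sign u (insert v G) * (if insert v G - {u} \<in> K then c (insert v G - {u}) else 0))"
        using False sgn[OF u] by (simp add: b_def ins flip: mult.assoc)
    qed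
    also have "\<dots> = c G"
      unfolding sum_distrib_left[symmetric] 0 by simp
    finally show ?thesis by simp
  qed
  then show ?thesis
    unfolding is_coboundary_def by blast
qed

section \<open>The Cech complex in a single fine degree\<close>

context monomial_quotient
begin

abbreviation "Cech i j \<equiv> cech_group n L i j"
abbreviation "\<delta> i \<equiv> cech_diff n L i"

lemma index_sets_subset: "F \<in> index_sets n i \<Longrightarrow> F \<subseteq> {1..n}"
  by (simp add: index_sets_def)

lemma index_sets_finite: "F \<in> index_sets n i \<Longrightarrow> finite F"
  by (auto simp: index_sets_def intro: finite_subset)

lemma index_sets_remove:
  "G \<in> index_sets n (Suc i) \<Longrightarrow> v \<in> G \<Longrightarrow> G - {v} \<in> index_sets n i"
  using index_sets_finite[of G "Suc i"] by (auto simp: index_sets_def)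

lemma cech_memD: "c \<in> carrier (Cech i j) \<Longrightarrow> F \<in> index_sets n i \<Longrightarrow> c F \<in> degree_part (C F) j"
  by (auto simp: cech_group_def)

lemma cech_memD': "c \<in> carrier (Cech i j) \<Longrightarrow> F \<in> index_sets n i \<Longrightarrow> c F \<in> carrier (C F)"
  using cech_memD degree_part_subset[OF index_sets_subset] by blast

lemma cech_eqI:
  assumes "c \<in> carrier (Cech i j)" "c' \<in> carrier (Cech i j)"
    and "\<And>F b g. F \<in> index_sets n i \<Longrightarrow> reduced b g \<Longrightarrow> coef F (c F) b g = coef F (c' F) b g"
  shows "c = c'"
proof (rule PiE_ext)
  show "c \<in> (\<Pi>\<^sub>E F\<in>index_sets n i. degree_part (C F) j)" "c' \<in> (\<Pi>\<^sub>E F\<in>index_sets n i. degree_part (C F) j)"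
    using assms(1,2) by (simp_all add: cech_group_def)
  show "c F = c' F" if "F \<in> index_sets n i" for F
    using assms that by (intro coef_eqI[OF index_sets_subset[OF that]]) (auto intro: cech_memD')
qed

lemma localization_map_mem:
  assumes "c \<in> carrier (Cech i j)" "G \<in> index_sets n (Suc i)" "v \<in> G"
  shows "localization_map S L (monomials G) (c (G - {v})) \<in> degree_part (C G) j"
  by (rule degree_part_localization_map[of "G - {v}"])
    (use assms index_sets_subset cech_memD index_sets_remove in auto)

lemma cech_diff_closed:
  assumes "c \<in> carrier (Cech i j)"
  shows "\<delta> i c \<in> carrier (Cech (Suc i) j)"
  using assms
  by (auto simp: cech_group_def[of n L "Suc i"] cech_diff_def index_sets_finite
    intro!: degree_part_finsum degree_part_sign localization_map_mem index_sets_subset)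

text \<open>Localization maps, signs and finite sums are all compatible with taking coefficients, so
  each fine degree carries its own combinatorial differential.\<close>

lemma coef_cech_diff:
  assumes c: "c \<in> carrier (Cech i j)" and G: "G \<in> index_sets n (Suc i)" and red: "reduced b g"
  shows "coef G (\<delta> i c G) b g =
    (if G \<in> K b g then cdiff (K b g) (\<lambda>F. coef F (c F) b g) G else 0)"
proof -
  note Gn = index_sets_subset[OF G]
  have mem: "localization_map S L (monomials G) (c (G - {v})) \<in> carrier (C G)" if "v \<in> G" for v
    using localization_map_mem[OF c G that] degree_part_subset[OF Gn] by blast
  have mem': "(-1) ^ k \<odot>\<^bsub>C G\<^esub> localization_map S L (monomials G) (c (G - {v})) \<in> carrier (C G)" if "v \<in> G" for v k
    using degree_part_sign[OF Gn localization_map_mem[OF c G that]] degree_part_subset[OF Gn] by blast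
  have "coef G (\<delta> i c G) b g =
      (\<Sum>v\<in>G. coef G ((-1) ^ card {w\<in>G. w < v} \<odot>\<^bsub>C G\<^esub> localization_map S L (monomials G) (c (G - {v}))) b g)"
    unfolding cech_diff_def using G by (simp add: coef_finsum[OF Gn index_sets_finite[OF G] mem'])
  also have "\<dots> = (\<Sum>v\<in>G. pos_sign v G * (if G \<in> K b g then coef (G - {v}) (c (G - {v})) b g else 0))"
  proof (rule sum.cong[OF refl])
    fix v assume v: "v \<in> G"
    have "coef G (localization_map S L (monomials G) (c (G - {v}))) b g =
        (if G \<in> K b g then coef (G - {v}) (c (G - {v})) b g else 0)"
      by (rule coef_localization_map) (use Gn red cech_memD'[OF c index_sets_remove[OF G v]] in auto)
    then show "coef G ((-1) ^ card {w\<in>G. w < v} \<odot>\<^bsub>C G\<^esub> localization_map S L (monomials G) (c (G - {v}))) b g =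
        pos_sign v G * (if G \<in> K b g then coef (G - {v}) (c (G - {v})) b g else 0)"
      by (simp add: coef_sign[OF Gn mem[OF v]] pos_sign_def)
  qed
  also have "\<dots> = (if G \<in> K b g then cdiff (K b g) (\<lambda>F. coef F (c F) b g) G else 0)"
    unfolding cdiff_def by (auto intro!: sum.cong simp: coef_outside)
  finally show ?thesis .
qed

lemma cech_one_closed: "\<one>\<^bsub>Cech i j\<^esub> \<in> carrier (Cech i j)"
  by (auto simp: cech_group_def intro!: degree_part_zero index_sets_subset)

lemma coef_cech_one: "F \<in> index_sets n i \<Longrightarrow> coef F (\<one>\<^bsub>Cech i j\<^esub> F) b g = 0"
  by (simp add: cech_group_def coef_zero[OF index_sets_subset])

lemma cech_mult_closed:
  "c \<in> carrier (Cech i j) \<Longrightarrow> c' \<in> carrier (Cech i j) \<Longrightarrow> c \<otimes>\<^bsub>Cech i j\<^esub> c' \<in> carrier (Cech i j)"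
  by (auto simp: cech_group_def intro!: degree_part_add index_sets_subset)

lemma coef_cech_mult:
  "c \<in> carrier (Cech i j) \<Longrightarrow> c' \<in> carrier (Cech i j) \<Longrightarrow> F \<in> index_sets n i \<Longrightarrow>
    coef F ((c \<otimes>\<^bsub>Cech i j\<^esub> c') F) b g = coef F (c F) b g + coef F (c' F) b g"
  using coef_add[OF index_sets_subset cech_memD' cech_memD', of F i c i j c' i j]
  by (simp add: cech_group_def)

lemma index_sets_iff_K: "F \<in> K b g \<Longrightarrow> F \<in> index_sets n i \<longleftrightarrow> card F = i"
  by (auto simp: index_sets_def degree_complex_def)

text \<open>Cocycles can be tested degree by degree because coefficients separate cochains.
  Coboundaries are harder: preimages in different degrees must first be assembled into one
  cochain.\<close>

lemma cech_cocycles_iff: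
  "c \<in> cech_cocycles n L i j \<longleftrightarrow> c \<in> carrier (Cech i j) \<and>
    (\<forall>b g. reduced b g \<longrightarrow> is_cocycle (K b g) i (\<lambda>F. coef F (c F) b g))"
proof (cases "c \<in> carrier (Cech i j)")
  case True
  have "\<delta> i c = \<one>\<^bsub>Cech (Suc i) j\<^esub> \<longleftrightarrow>
      (\<forall>G\<in>index_sets n (Suc i). \<forall>b g. reduced b g \<longrightarrow> coef G (\<delta> i c G) b g = 0)"
    using cech_eqI[OF cech_diff_closed[OF True] cech_one_closed] by (auto simp: coef_cech_one)
  also have "\<dots> \<longleftrightarrow> (\<forall>b g. reduced b g \<longrightarrow> is_cocycle (K b g) i (\<lambda>F. coef F (c F) b g))"
    unfolding is_cocycle_def using index_sets_iff_K
    by (auto simp: coef_cech_diff[OF True])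
  finally show ?thesis
    using True by (simp add: cech_cocycles_def)
qed (simp add: cech_cocycles_def)

section \<open>Coboundaries and the quotient by them\<close>

lemma cech_diff_linear:
  assumes "c \<in> carrier (Cech i j)" "c' \<in> carrier (Cech i j)" "r \<in> {1, -1}"
  shows "\<exists>d\<in>carrier (Cech i j). \<forall>F\<in>index_sets n i. \<forall>b g.
    coef F (d F) b g = coef F (c F) b g + r * coef F (c' F) b g"
proof (cases "r = 1")
  case True
  then show ?thesis
    using assms by (intro bexI[of _ "c \<otimes>\<^bsub>Cech i j\<^esub> c'"]) (auto simp: coef_cech_mult cech_mult_closed)
next
  case False
  define c'' where "c'' = (\<lambda>F\<in>index_sets n i. (-1) ^ 1 \<odot>\<^bsub>C F\<^esub> c' F)"
  have c'': "c'' \<in> carrier (Cech i j)"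
    unfolding c''_def cech_group_def
    using assms(2) by (auto intro!: degree_part_sign[where k = 1, OF index_sets_subset cech_memD[OF assms(2)], simplified])
  have "coef F (c'' F) b g = - coef F (c' F) b g" if "F \<in> index_sets n i" for F b g
    using coef_sign[OF index_sets_subset[OF that] cech_memD'[OF assms(2) that], of 1] that
    by (simp add: c''_def)
  then show ?thesis
    using assms False c'' by (intro bexI[of _ "c \<otimes>\<^bsub>Cech i j\<^esub> c''"]) (auto simp: coef_cech_mult cech_mult_closed)
qed

text \<open>Together the two closure properties make the coset of a coboundary equal to the whole
  set of coboundaries. For positive \<open>i\<close> both are checked on coefficients through
  linearity of \<open>cdiff\<close>; for \<open>i = 0\<close> the zero cochain is the only
  coboundary.\<close>

lemma coboundaries_closed:
  assumes "c \<in> cech_coboundaries n L i j" "c' \<in> cech_coboundaries n L i j"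
  shows "c \<otimes>\<^bsub>Cech i j\<^esub> c' \<in> cech_coboundaries n L i j"
    and "\<exists>d\<in>cech_coboundaries n L i j. d \<otimes>\<^bsub>Cech i j\<^esub> c' = c"
proof -
  have "c \<otimes>\<^bsub>Cech i j\<^esub> c' \<in> cech_coboundaries n L i j \<and>
      (\<exists>d\<in>cech_coboundaries n L i j. d \<otimes>\<^bsub>Cech i j\<^esub> c' = c)"
  proof (cases i)
    case 0
    have "\<one>\<^bsub>Cech i j\<^esub> \<otimes>\<^bsub>Cech i j\<^esub> \<one>\<^bsub>Cech i j\<^esub> = \<one>\<^bsub>Cech i j\<^esub>"
      by (rule cech_eqI) (auto intro: cech_mult_closed cech_one_closed simp: coef_cech_mult cech_one_closed coef_cech_one)
    then show ?thesis
      using assms 0 by (simp add: cech_coboundaries_def)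
  next
    case (Suc h)
    obtain y y' where y: "y \<in> carrier (Cech h j)" "c = \<delta> h y" and y': "y' \<in> carrier (Cech h j)" "c' = \<delta> h y'"
      using assms Suc by (auto simp: cech_coboundaries_def)
    have dd: "coef F (\<delta> h d F) b g = coef F (\<delta> h y F) b g + r * coef F (\<delta> h y' F) b g"
      if "d \<in> carrier (Cech h j)" "\<And>F b g. F \<in> index_sets n h \<Longrightarrow> coef F (d F) b g = coef F (y F) b g + r * coef F (y' F) b g"
        "F \<in> index_sets n i" "reduced b g" for d r F b g
    proof -
      have "cdiff (K b g) (\<lambda>F. coef F (d F) b g) F = cdiff (K b g) (\<lambda>F. coef F (y F) b g + r * coef F (y' F) b g) F"
        unfolding cdiff_def
        by (rule sum.cong) (use that index_sets_remove Suc in auto)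
      then show ?thesis
        using that y y' Suc by (simp add: coef_cech_diff cdiff_linear)
    qed
    obtain d where d: "d \<in> carrier (Cech h j)"
      "\<And>F b g. F \<in> index_sets n h \<Longrightarrow> coef F (d F) b g = coef F (y F) b g + 1 * coef F (y' F) b g"
      using cech_diff_linear[OF y(1) y'(1), of 1] by auto
    obtain e where e: "e \<in> carrier (Cech h j)"
      "\<And>F b g. F \<in> index_sets n h \<Longrightarrow> coef F (e F) b g = coef F (y F) b g + (- 1) * coef F (y' F) b g"
      using cech_diff_linear[OF y(1) y'(1), of "-1"] by auto
    have car: "\<delta> h x \<in> carrier (Cech i j)" if "x \<in> carrier (Cech h j)" for x
      using cech_diff_closed[OF that] Suc by simp
    have "\<delta> h d = \<delta> h y \<otimes>\<^bsub>Cech i j\<^esub> \<delta> h y'"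
      using dd[OF d] by (intro cech_eqI[of _ i j]) (auto simp: coef_cech_mult car d y y' intro: cech_mult_closed)
    moreover have "\<delta> h e \<otimes>\<^bsub>Cech i j\<^esub> \<delta> h y' = \<delta> h y"
      using dd[OF e] by (intro cech_eqI[of _ i j]) (auto simp: coef_cech_mult car e y y' intro: cech_mult_closed)
    moreover have "\<delta> h d \<in> cech_coboundaries n L i j" "\<delta> h e \<in> cech_coboundaries n L i j"
      using d(1) e(1) Suc by (auto simp: cech_coboundaries_def)
    ultimately show ?thesis
      using y(2) y'(2) by auto
  qed
  then show "c \<otimes>\<^bsub>Cech i j\<^esub> c' \<in> cech_coboundaries n L i j"
    "\<exists>d\<in>cech_coboundaries n L i j. d \<otimes>\<^bsub>Cech i j\<^esub> c' = c" by auto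
qed

lemma coboundaries_one: "\<one>\<^bsub>Cech i j\<^esub> \<in> cech_coboundaries n L i j"
proof (cases i)
  case (Suc h)
  have "\<delta> h \<one>\<^bsub>Cech h j\<^esub> = \<one>\<^bsub>Cech i j\<^esub>"
  proof (rule cech_eqI[of _ i j])
    fix F b g assume F: "F \<in> index_sets n i" and red: "reduced b g"
    have "cdiff (K b g) (\<lambda>F. coef F (\<one>\<^bsub>Cech h j\<^esub> F) b g) F = 0"
      unfolding cdiff_def
      by (rule sum.neutral) (use F index_sets_remove Suc in \<open>auto simp: coef_cech_one\<close>)
    then show "coef F (\<delta> h \<one>\<^bsub>Cech h j\<^esub> F) b g = coef F (\<one>\<^bsub>Cech i j\<^esub> F) b g"
      using F red Suc by (simp add: coef_cech_diff[OF cech_one_closed] coef_cech_one)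
  qed (use Suc cech_diff_closed[OF cech_one_closed] cech_one_closed in auto)
  then show ?thesis
    using Suc cech_one_closed[of h j] by (force simp: cech_coboundaries_def)
qed (simp add: cech_coboundaries_def)

lemma one_mult_cech:
  assumes "c \<in> carrier (Cech i j)"
  shows "\<one>\<^bsub>Cech i j\<^esub> \<otimes>\<^bsub>Cech i j\<^esub> c = c"
  by (rule cech_eqI) (use assms in \<open>auto intro: cech_mult_closed cech_one_closed simp: coef_cech_mult cech_one_closed coef_cech_one\<close>)

text \<open>The unit of the quotient is the set of coboundaries itself. A cocycle that is a
  coboundary has this set as its coset; any other cocycle lies in its own coset, which therefore
  differs from it.\<close>

lemma local_cohomology_nontrivial_iff:
  "carrier (local_cohomology n L i j) \<noteq> {\<one>\<^bsub>local_cohomology n L i j\<^esub>} \<longleftrightarrow>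
    \<not> cech_cocycles n L i j \<subseteq> cech_coboundaries n L i j"
proof -
  let ?Z = "cech_cocycles n L i j" and ?B = "cech_coboundaries n L i j"
  define co where "co z = (\<Union>h\<in>?B. {h \<otimes>\<^bsub>Cech i j\<^esub> z})" for z
  have car: "carrier (local_cohomology n L i j) = co ` ?Z"
    by (auto simp: local_cohomology_def carrier_FactGroup r_coset_def co_def)
  have one: "\<one>\<^bsub>local_cohomology n L i j\<^esub> = ?B"
    by (simp add: local_cohomology_def)
  have Z: "\<one>\<^bsub>Cech i j\<^esub> \<in> ?Z"
    unfolding cech_cocycles_iff is_cocycle_def
  proof (intro conjI allI impI ballI cech_one_closed)
    fix b g G assume "reduced b g" "G \<in> K b g" "card G = Suc i"
    then have "G \<in> index_sets n (Suc i)" using index_sets_iff_K by blast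
    then show "cdiff (K b g) (\<lambda>F. coef F (\<one>\<^bsub>Cech i j\<^esub> F) b g) G = 0"
      unfolding cdiff_def by (intro sum.neutral) (use index_sets_remove in \<open>auto simp: coef_cech_one\<close>)
  qed
  show ?thesis
  proof (cases "?Z \<subseteq> ?B")
    case True
    have "co z = ?B" if "z \<in> ?Z" for z
      using that True coboundaries_closed[of _ i j z] unfolding co_def by blast
    then have "co ` ?Z = {?B}" using Z by auto
    then show ?thesis using True car one by simp
  next
    case False
    then obtain z where z: "z \<in> ?Z" "z \<notin> ?B" by blast
    have "z \<in> co z"
      unfolding co_def using coboundaries_one[of i j] one_mult_cech[of z i j] z(1)
      by (auto simp: cech_cocycles_iff intro!: bexI)
    then have "co z \<noteq> ?B" using z by auto
    then show ?thesis using False car one z(1) by auto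
  qed
qed

text \<open>The combinatorial cocycle is placed in the degree \<open>(b, g)\<close>, with all other
  coefficients 0. A Cech preimage would restrict to a combinatorial preimage in that degree.\<close>

lemma local_cohomology_nontrivialI:
  fixes c :: "nat set \<Rightarrow> 'k"
  assumes red: "reduced b g" and b: "b \<in> exponents n" and deg: "int (mdeg b) - int (mdeg g) = j"
    and cocycle: "is_cocycle (K b g) i c" and nb: "\<not> is_coboundary (K b g) i c"
  shows "carrier (local_cohomology n L i j) \<noteq> {\<one>\<^bsub>local_cohomology n L i j\<^esub>}"
proof -
  have "\<exists>X\<in>degree_part (C F) j. \<forall>b' g'. reduced b' g' \<longrightarrow>
      coef F X b' g' = (if (b', g') \<in> {(b, g)} \<and> F \<in> K b' g' then c F else 0)"
    if "F \<in> index_sets n i" for F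
    by (rule lift_coef[OF index_sets_subset[OF that]]) (use red b deg in auto)
  then obtain X where X: "\<And>F. F \<in> index_sets n i \<Longrightarrow> X F \<in> degree_part (C F) j"
    "\<And>F b' g'. F \<in> index_sets n i \<Longrightarrow> reduced b' g' \<Longrightarrow>
      coef F (X F) b' g' = (if b' = b \<and> g' = g \<and> F \<in> K b' g' then c F else 0)"
    by simp metis
  define z where "z = restrict X (index_sets n i)"
  have z: "z \<in> carrier (Cech i j)"
    using X(1) by (auto simp: z_def cech_group_def)
  have coefz: "coef F (z F) b' g' = (if b' = b \<and> g' = g \<and> F \<in> K b' g' then c F else 0)"
    if "F \<in> index_sets n i" "reduced b' g'" for F b' g'
    using X(2)[OF that] that(1) by (simp add: z_def)
  have "is_cocycle (K b' g') i (\<lambda>F. coef F (z F) b' g')" if red': "reduced b' g'" for b' g'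
    unfolding is_cocycle_def
  proof (intro ballI impI)
    fix G assume G: "G \<in> K b' g'" "card G = Suc i"
    then have "G \<in> index_sets n (Suc i)" using index_sets_iff_K by blast
    then have "cdiff (K b' g') (\<lambda>F. coef F (z F) b' g') G =
        cdiff (K b' g') (\<lambda>F. if b' = b \<and> g' = g then c F else 0) G"
      unfolding cdiff_def
      by (intro sum.cong) (use index_sets_remove coefz red' in auto)
    also have "\<dots> = 0"
      using cocycle G by (cases "b' = b \<and> g' = g") (auto simp: is_cocycle_def)
    finally show "cdiff (K b' g') (\<lambda>F. coef F (z F) b' g') G = 0" .
  qed
  then have "z \<in> cech_cocycles n L i j"
    using z by (simp add: cech_cocycles_iff)
  moreover have "z \<notin> cech_coboundaries n L i j"
  proof
    assume zB: "z \<in> cech_coboundaries n L i j"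
    have "\<exists>y. \<forall>F\<in>K b g. card F = i \<longrightarrow> c F = cdiff (K b g) y F"
    proof (cases i)
      case 0
      have "c F = 0" if "F \<in> K b g" "card F = i" for F
        using zB 0 coefz[of F b g] that red index_sets_iff_K[OF that(1), of i] coef_cech_one[of F i j b g]
        by (simp add: cech_coboundaries_def)
      then show ?thesis by (intro exI[of _ "\<lambda>F. 0"]) simp
    next
      case (Suc h)
      then obtain y where y: "y \<in> carrier (Cech h j)" "z = \<delta> h y"
        using zB by (auto simp: cech_coboundaries_def)
      have "c F = cdiff (K b g) (\<lambda>F. coef F (y F) b g) F" if "F \<in> K b g" "card F = i" for F
        using coef_cech_diff[OF y(1), of F b g] coefz[of F b g] that red Suc
          index_sets_iff_K[OF that(1), of i] y(2) by simp
      then show ?thesis by blast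
    qed
    then show False
      using nb by (simp add: is_coboundary_def)
  qed
  ultimately show ?thesis
    unfolding local_cohomology_nontrivial_iff by blast
qed

text \<open>Otherwise every degree has a combinatorial preimage. A Cech cocycle has nonzero
  coefficients in finitely many degrees only, so the chosen preimages lift to a single Cech
  cochain.\<close>

lemma local_cohomology_nontrivialE:
  assumes "carrier (local_cohomology n L i j) \<noteq> {\<one>\<^bsub>local_cohomology n L i j\<^esub>}"
  obtains (witness) b g and c :: "nat set \<Rightarrow> 'k"
  where "reduced b g" "b \<in> exponents n" "int (mdeg b) - int (mdeg g) = j"
    "is_cocycle (K b g) i c" "\<not> is_coboundary (K b g) i c"
proof (rule ccontr)
  assume contra: "\<not> thesis"
  have acyclic: "is_coboundary (K b g) i c"
    if "reduced b g" "b \<in> exponents n" "int (mdeg b) - int (mdeg g) = j" "is_cocycle (K b g) i c"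
    for b g and c :: "nat set \<Rightarrow> 'k"
    using contra witness[OF that] by blast
  obtain c where c: "c \<in> cech_cocycles n L i j" and cB: "c \<notin> cech_coboundaries n L i j"
    using assms unfolding local_cohomology_nontrivial_iff by blast
  have car: "c \<in> carrier (Cech i j)" and
    cocycle: "\<And>b g. reduced b g \<Longrightarrow> is_cocycle (K b g) i (\<lambda>F. coef F (c F) b g)"
    using c by (auto simp: cech_cocycles_iff)
  define D where "D = (\<Union>F\<in>index_sets n i. {(b, g). reduced b g \<and> coef F (c F) b g \<noteq> 0})"
  have "finite (index_sets n i)"
    by (rule finite_subset[of _ "Pow {1..n}"]) (auto simp: index_sets_def)
  then have finD: "finite D"
    unfolding D_def
    using finite_coef_support[OF index_sets_subset cech_memD'[OF car]] by (intro finite_UN_I) auto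
  have D: "reduced b g \<and> b \<in> exponents n \<and> int (mdeg b) - int (mdeg g) = j" if "(b, g) \<in> D" for b g
    using that coef_degree[OF cech_memD[OF car]] by (auto simp: D_def)
  have "\<exists>y. \<forall>F\<in>K b g. card F = i \<longrightarrow> coef F (c F) b g = cdiff (K b g) y F" if "(b, g) \<in> D" for b g
    using acyclic[OF _ _ _ cocycle] D[OF that] by (auto simp: is_coboundary_def)
  then obtain y where y: "\<And>b g F. (b, g) \<in> D \<Longrightarrow> F \<in> K b g \<Longrightarrow> card F = i \<Longrightarrow>
      coef F (c F) b g = cdiff (K b g) (y b g) F"
    by metis
  have coefc: "coef F (c F) b g = (if (b, g) \<in> D \<and> F \<in> K b g then cdiff (K b g) (y b g) F else 0)"
    if "F \<in> index_sets n i" "reduced b g" for F b g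
    using that y index_sets_iff_K[of F b g i] by (auto simp: D_def coef_outside)
  have "c \<in> cech_coboundaries n L i j"
  proof (cases i)
    case 0
    \<comment> \<open>With \<open>i = 0\<close> the only index is \<open>{}\<close>, where a
      combinatorial coboundary is 0.\<close>
    have "F = {}" if "F \<in> index_sets n i" for F
      using that 0 index_sets_finite[OF that] by (simp add: index_sets_def)
    then have "c = \<one>\<^bsub>Cech i j\<^esub>"
      by (intro cech_eqI[OF car cech_one_closed]) (metis coefc coef_cech_one cdiff_empty)
    then show ?thesis
      using 0 by (simp add: cech_coboundaries_def)
  next
    case (Suc h)
    have "\<exists>X\<in>degree_part (C F) j. \<forall>b g. reduced b g \<longrightarrow>
        coef F X b g = (if (b, g) \<in> D \<and> F \<in> K b g then y b g F else 0)"
      if "F \<in> index_sets n h" for F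
      by (rule lift_coef[OF index_sets_subset[OF that] finD D])
    then obtain X where X: "\<And>F. F \<in> index_sets n h \<Longrightarrow> X F \<in> degree_part (C F) j"
      "\<And>F b g. F \<in> index_sets n h \<Longrightarrow> reduced b g \<Longrightarrow>
        coef F (X F) b g = (if (b, g) \<in> D \<and> F \<in> K b g then y b g F else 0)"
      by metis
    define z where "z = restrict X (index_sets n h)"
    have z: "z \<in> carrier (Cech h j)"
      using X(1) by (auto simp: z_def cech_group_def)
    have "\<delta> h z = c"
    proof (rule cech_eqI[of _ i j])
      show "\<delta> h z \<in> carrier (Cech i j)"
        using cech_diff_closed[OF z] Suc by simp
      fix F b g assume F: "F \<in> index_sets n i" and red: "reduced b g"
      have "cdiff (K b g) (\<lambda>F. coef F (z F) b g) F =
          cdiff (K b g) (\<lambda>F. if (b, g) \<in> D then y b g F else 0) F"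
        unfolding cdiff_def
        by (intro sum.cong) (use F Suc index_sets_remove X(2) red in \<open>auto simp: z_def\<close>)
      then show "coef F (\<delta> h z F) b g = coef F (c F) b g"
        using coef_cech_diff[OF z, of F b g] coefc[of F b g] F red Suc by simp
    qed (rule car)
    then show ?thesis
      using z Suc by (auto simp: cech_coboundaries_def)
  qed
  then show False using cB by blast
qed

end


section \<open>Comparison of regularities\<close>

text \<open>For an upset inside \<open>exponents n\<close> this says that the minimal generators
  have exponents at most \<open>d\<close> in every variable. The form avoids generators, so it can
  be verified directly for symbolic powers.\<close>

definition var_bounded :: "nat \<Rightarrow> exponent set \<Rightarrow> bool" where
  "var_bounded d M \<longleftrightarrow>
    (\<forall>m v. d \<le> lookup m v \<longrightarrow> m + Poly_Mapping.single v 1 \<in> M \<longrightarrow> m \<in> M)"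

lemma var_bounded_power:
  assumes "var_bounded d M" "d \<le> lookup b v" "b + Poly_Mapping.single v k \<in> M"
  shows "b \<in> M"
  using assms(3)
proof (induction k)
  case (Suc k)
  have "b + Poly_Mapping.single v k + Poly_Mapping.single v 1 \<in> M"
    using Suc.prems by (simp add: add.assoc flip: single_add)
  then have "b + Poly_Mapping.single v k \<in> M"
    using assms(1,2) unfolding var_bounded_def by (metis lookup_add trans_le_add1)
  then show ?case by (rule Suc.IH)
qed simp

lemma var_bounded_remove:
  assumes "var_bounded d M" "d \<le> lookup b v" "b + w \<in> M"
  shows "\<exists>w'. keys w' \<subseteq> keys w - {v} \<and> b + w' \<in> M"
proof -
  define w' where "w' = Poly_Mapping.update v 0 w"
  have "w = w' + Poly_Mapping.single v (lookup w v)"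
    by (rule poly_mapping_eqI) (auto simp: w'_def lookup_update lookup_add lookup_single)
  then have "(b + w') + Poly_Mapping.single v (lookup w v) \<in> M"
    using assms(3) by (simp add: add.assoc)
  moreover have "d \<le> lookup (b + w') v"
    using assms(2) by (simp add: lookup_add)
  ultimately have "b + w' \<in> M"
    using var_bounded_power[OF assms(1)] by blast
  then show ?thesis
    by (intro exI[of _ w']) (auto simp: w'_def keys_update)
qed

lemma degree_complex_toggle:
  assumes M: "var_bounded d M" and v: "d \<le> lookup b v" "v \<notin> keys g" "v \<in> {1..n}" and F: "v \<notin> F"
  shows "F \<in> degree_complex n M b g \<longleftrightarrow> insert v F \<in> degree_complex n M b g"
proof
  assume FK: "F \<in> degree_complex n M b g"
  have "b + w \<notin> M" if "keys w \<subseteq> insert v F" for w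
  proof
    assume "b + w \<in> M"
    then obtain w' where "keys w' \<subseteq> keys w - {v}" "b + w' \<in> M"
      using var_bounded_remove[OF M v(1)] by blast
    moreover from this that have "keys w' \<subseteq> F" by blast
    ultimately show False using FK by (auto simp: degree_complex_def)
  qed
  then show "insert v F \<in> degree_complex n M b g"
    using FK v by (auto simp: degree_complex_def)
next
  assume "insert v F \<in> degree_complex n M b g"
  then show "F \<in> degree_complex n M b g"
    using v F by (auto simp: degree_complex_def)
qed

lemma degree_complex_finite: "F \<in> degree_complex n M b g \<Longrightarrow> finite F"
  by (auto simp: degree_complex_def intro: finite_subset)

section \<open>The Stanley-Reisner complex and degrees off a face\<close>

definition faces :: "nat \<Rightarrow> exponent set \<Rightarrow> nat set set" where
  "faces n M = {F. F \<subseteq> {1..n} \<and> (\<forall>w. keys w \<subseteq> F \<longrightarrow> w \<notin> M)}"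

definition facets :: "nat \<Rightarrow> exponent set \<Rightarrow> nat set set" where
  "facets n M = {F \<in> faces n M. \<forall>G\<in>faces n M. F \<subseteq> G \<longrightarrow> G = F}"

lemma face_in_facet:
  assumes "F \<in> faces n M"
  obtains G where "G \<in> facets n M" "F \<subseteq> G"
proof -
  have "finite (faces n M)"
    by (rule finite_subset[of _ "Pow {1..n}"]) (auto simp: faces_def)
  from finite_has_maximal2[OF this assms]
  obtain G where "G \<in> faces n M" "F \<subseteq> G" "\<forall>H\<in>faces n M. G \<subseteq> H \<longrightarrow> G = H"
    by (elim bexE conjE)
  then show thesis by (intro that[of G]) (auto simp: facets_def)
qed

text \<open>The order of \<open>x^m\<close> along the prime generated by the variables off
  \<open>F\<close>: for \<open>m\<close> in \<open>exponents n\<close>, the monomial lies in the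
  \<open>s\<close>-th power of that prime exactly when this number is at least
  \<open>s\<close>.\<close>

definition off_degree :: "nat \<Rightarrow> nat set \<Rightarrow> exponent \<Rightarrow> nat" where
  "off_degree n F m = (\<Sum>v\<in>{1..n} - F. lookup m v)"

lemma off_degree_add [simp]: "off_degree n F (m + w) = off_degree n F m + off_degree n F w"
  by (simp add: off_degree_def lookup_add sum.distrib)

lemma off_degree_eq_0_iff: "m \<in> exponents n \<Longrightarrow> off_degree n F m = 0 \<longleftrightarrow> keys m \<subseteq> F"
  by (auto simp: off_degree_def exponents_def in_keys_iff)

lemma off_degree_antimono: "F \<subseteq> G \<Longrightarrow> off_degree n G m \<le> off_degree n F m"
  unfolding off_degree_def by (rule sum_mono2) auto

lemma off_degree_ge: "v \<in> {1..n} - F \<Longrightarrow> lookup m v \<le> off_degree n F m"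
  unfolding off_degree_def by (rule member_le_sum) auto

lemma off_degree_single:
  "off_degree n F (Poly_Mapping.single v k) = (if v \<in> {1..n} - F then k else 0)"
  by (simp add: off_degree_def lookup_single when_def sum.delta)

definition indicator_exponent :: "nat set \<Rightarrow> exponent" where
  "indicator_exponent F = (\<Sum>v\<in>F. Poly_Mapping.single v 1)"

lemma lookup_indicator_exponent:
  "finite F \<Longrightarrow> lookup (indicator_exponent F) v = (if v \<in> F then 1 else 0)"
  by (simp add: indicator_exponent_def lookup_sum lookup_single when_def sum.delta)

lemma keys_indicator_exponent: "finite F \<Longrightarrow> keys (indicator_exponent F) = F"
  by (auto simp: in_keys_iff lookup_indicator_exponent split: if_splits)

lemma zero_exponent_not_in_monomial_ideal:
  assumes "upset n M" "monomial_ideal M \<noteq> carrier (mpoly_ring n)"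
  shows "0 \<notin> M"
proof
  assume "0 \<in> M"
  then have "M = exponents n"
    using upsetD[OF assms(1), of 0] upset_subset[OF assms(1)] by auto
  then show False using assms(2) by (simp add: carrier_mpoly_ring)
qed

section \<open>Regularity as a bounded supremum\<close>

context monomial_quotient
begin

definition reg_set :: "int set" where
  "reg_set = {int i + j | i j. carrier (local_cohomology n L i j) \<noteq> {\<one>\<^bsub>local_cohomology n L i j\<^esub>}}"

lemma reg_ideal_eq: "reg_ideal n J = Sup reg_set + 1"
  by (simp add: reg_ideal_def reg_module_def reg_set_def)

text \<open>From exponent \<open>d\<close> on the complex would be a cone with apex
  \<open>v\<close>. For \<open>d = 1\<close> this leaves only \<open>b = 0\<close>; for general
  \<open>d\<close> it bounds the regularity.\<close>

lemma essential_cocycle_small_degree: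
  fixes c :: "nat set \<Rightarrow> 'k"
  assumes "var_bounded d M" "reduced b g" "b \<in> exponents n"
    and "is_cocycle (K b g) i c" "\<not> is_coboundary (K b g) i c"
    and v: "v \<in> keys b"
  shows "lookup b v < d"
proof (rule ccontr)
  assume "\<not> lookup b v < d"
  then have "is_coboundary (K b g) i c"
    using assms
    by (intro cone_cocycle_is_coboundary[of "K b g" v] degree_complex_finite degree_complex_toggle)
      (auto simp: reduced_def exponents_def)
  then show False using assms by blast
qed

text \<open>A coarse bound is enough: \<open>i \<le> n\<close> because a cocycle that is not a
  coboundary requires a member of size \<open>i\<close>, the positive part of the degree is at most
  \<open>n * d\<close>, and the negative part only lowers it.\<close>

lemma bdd_above_reg_set:
  assumes "var_bounded d M"
  shows "bdd_above reg_set"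
proof (rule bdd_aboveI)
  fix x assume "x \<in> reg_set"
  then obtain i j where x: "x = int i + j"
    and nt: "carrier (local_cohomology n L i j) \<noteq> {\<one>\<^bsub>local_cohomology n L i j\<^esub>}"
    by (auto simp: reg_set_def)
  from nt obtain b g and c :: "nat set \<Rightarrow> 'k"
    where w: "reduced b g" "b \<in> exponents n" "int (mdeg b) - int (mdeg g) = j"
      "is_cocycle (K b g) i c" "\<not> is_coboundary (K b g) i c"
    by (rule local_cohomology_nontrivialE)
  obtain F where F: "F \<in> K b g" "card F = i"
    using w(5) by (auto simp: is_coboundary_def)
  have "card F \<le> card {1..n}"
    using F by (intro card_mono) (auto simp: degree_complex_def)
  then have i: "i \<le> n" using F by simp
  have "mdeg b = (\<Sum>v\<in>{1..n}. lookup b v)"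
    by (rule mdeg_eq_sum) (use w(2) in \<open>auto simp: exponents_def\<close>)
  also have "\<dots> \<le> (\<Sum>v\<in>{1..n}. d)"
  proof (rule sum_mono)
    fix v
    show "lookup b v \<le> d"
      using essential_cocycle_small_degree[OF assms w(1,2,4,5), of v] by (cases "v \<in> keys b") (auto simp: in_keys_iff)
  qed
  finally have "int (mdeg b) \<le> int (n * d)" by (simp flip: of_nat_mult)
  then show "x \<le> int n + int (n * d)"
    using w(3) i x by linarith
qed

text \<open>In degree \<open>-1\<close> on a facet \<open>F\<close> the complex consists of \<open>F\<close> alone.\<close>

lemma reg_set_nonempty:
  assumes "0 \<notin> M"
  shows "reg_set \<noteq> {}"
proof -
  have "{} \<in> faces n M" using assms by (auto simp: faces_def)
  then obtain F where F: "F \<in> facets n M" by (rule face_in_facet)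
  have fin: "finite F" "F \<subseteq> {1..n}"
    using F by (auto simp: facets_def faces_def intro: finite_subset)
  define g where "g = indicator_exponent F"
  have g: "keys g = F" by (simp add: g_def keys_indicator_exponent fin)
  have K: "K 0 g = {F}"
    using F g by (auto simp: degree_complex_def facets_def faces_def)
  have "F - {v} \<noteq> F" if "v \<in> F" for v using that by blast
  then have "cdiff (K 0 g) y F = (0 :: 'k)" for y
    unfolding cdiff_def K by (intro sum.neutral) auto
  then have "carrier (local_cohomology n L (card F) (- int (mdeg g))) \<noteq>
      {\<one>\<^bsub>local_cohomology n L (card F) (- int (mdeg g))\<^esub>}"
    by (intro local_cohomology_nontrivialI[of 0 g _ _ "\<lambda>F. 1"])
      (auto simp: reduced_def mdeg_def is_cocycle_def is_coboundary_def K)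
  then show ?thesis by (auto simp: reg_set_def)
qed

end

text \<open>An abstract \<open>N\<close> covers both powers: \<open>power\<close> passes to every
  ideal containing \<open>I^s\<close>, and \<open>off\<close> holds for every monomial ideal inside
  the \<open>s\<close>-th powers of all primes of faces.\<close>

lemma reg_ideal_comparison:
  fixes J J' :: "'k::field mpoly set"
  assumes J: "monomial_quotient n M J" and J': "monomial_quotient n N J'"
    and M: "var_bounded 1 M" "0 \<notin> M" "M \<noteq> {}" and N: "var_bounded s N" and s: "s \<ge> 1"
    and power: "\<And>m. m \<in> M \<Longrightarrow> \<exists>w\<in>N. keys w \<subseteq> keys m"
    and off: "\<And>F m. F \<in> faces n M \<Longrightarrow> m \<in> N \<Longrightarrow> s \<le> off_degree n F m"
  shows "reg_ideal n J + int s - 1 \<le> reg_ideal n J'"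
proof -
  interpret J: monomial_quotient n M J by (rule J)
  interpret J': monomial_quotient n N J' by (rule J')
  have "x \<le> Sup J'.reg_set - (int s - 1)" if "x \<in> J.reg_set" for x
  proof -
    from that obtain i j where x: "x = int i + j"
      and nt: "carrier (local_cohomology n J.L i j) \<noteq> {\<one>\<^bsub>local_cohomology n J.L i j\<^esub>}"
      by (auto simp: J.reg_set_def)
    from nt obtain b g and c :: "nat set \<Rightarrow> 'k"
      where w: "reduced b g" "b \<in> exponents n" "int (mdeg b) - int (mdeg g) = j"
        "is_cocycle (J.K b g) i c" "\<not> is_coboundary (J.K b g) i c"
      by (rule J.local_cohomology_nontrivialE)
    \<comment> \<open>The bound 1 from squarefreeness enters here: exponents below 1 are 0.\<close>
    have "v \<notin> keys b" for v
      using J.essential_cocycle_small_degree[OF M(1) w(1,2,4,5), of v] by (auto simp: in_keys_iff)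
    then have b: "b = 0" by (intro keys_eq_empty) blast
    obtain F where F: "F \<in> J.K 0 g"
      using w(5) by (auto simp: is_coboundary_def b)
    obtain m where m: "m \<in> M" using M(3) by blast
    \<comment> \<open>Any exponent in \<open>M\<close> is supported on \<open>{1..n}\<close>, so the
      full vertex set is not in the complex.\<close>
    have "F \<noteq> {1..n}"
      using F m upset_subset[OF J.upset] by (auto simp: degree_complex_def exponents_def)
    moreover have "F \<subseteq> {1..n}"
      using F by (auto simp: degree_complex_def)
    ultimately obtain v where v: "v \<in> {1..n}" "v \<notin> F"
      by blast
    then have vg: "v \<notin> keys g" using F by (auto simp: degree_complex_def)
    \<comment> \<open>From exponent \<open>s\<close> on, toggling \<open>v\<close> would make the
      complex of \<open>N\<close> acyclic, so \<open>s - 1\<close> is the largest possible shift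
      along \<open>v\<close>.\<close>
    define b' where "b' = Poly_Mapping.single v (s - 1)"
    have "G \<in> J.K 0 g \<longleftrightarrow> G \<in> J'.K b' g" if G: "G \<subseteq> {1..n}" "keys g \<subseteq> G" for G
    proof
      assume "G \<in> J.K 0 g"
      then have face: "G \<in> faces n M" by (auto simp: degree_complex_def faces_def)
      have "b' + w \<notin> N" if "keys w \<subseteq> G" for w
      proof
        assume "b' + w \<in> N"
        then have "s \<le> off_degree n G (b' + w)" by (rule off[OF face])
        moreover have "off_degree n G w = 0"
          using that G by (subst off_degree_eq_0_iff) (auto simp: exponents_def)
        \<comment> \<open>If \<open>v\<close> lies in \<open>G\<close>, the variable
          \<open>x_v\<close> does not count; otherwise it contributes \<open>s - 1\<close>, still
          less than \<open>s\<close>.\<close>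
        ultimately show False using s by (simp add: b'_def off_degree_single split: if_splits)
      qed
      then show "G \<in> J'.K b' g" using G by (auto simp: degree_complex_def)
    next
      assume G': "G \<in> J'.K b' g"
      have "w \<notin> M" if "keys w \<subseteq> G" for w
      proof
        assume "w \<in> M"
        then obtain u where u: "u \<in> N" "keys u \<subseteq> keys w" using power by blast
        have "u + b' \<in> N"
          by (rule upsetD[OF J'.upset u(1)]) (use v in \<open>auto simp: b'_def exponents_def\<close>)
        then have "b' + u \<in> N" by (simp add: add.commute)
        moreover have "keys u \<subseteq> G" using u that by blast
        ultimately show False
          using G' by (auto simp: degree_complex_def)
      qed
      then show "G \<in> J.K 0 g" using G by (auto simp: degree_complex_def)
    qed
    then have K: "J'.K b' g = J.K 0 g"
      by (auto simp: degree_complex_def)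
    have "mdeg b' = s - 1" "mdeg (0 :: exponent) = 0"
      by (auto simp: b'_def mdeg_def)
    moreover have "reduced b' g" "b' \<in> exponents n"
      using vg v by (auto simp: b'_def reduced_def exponents_def)
    ultimately have "carrier (local_cohomology n J'.L i (j + (int s - 1))) \<noteq>
        {\<one>\<^bsub>local_cohomology n J'.L i (j + (int s - 1))\<^esub>}"
      using w s unfolding b
      by (intro J'.local_cohomology_nontrivialI[of b' g _ _ c]) (auto simp: K)
    then have "int i + (j + (int s - 1)) \<in> J'.reg_set"
      by (auto simp: J'.reg_set_def)
    then have "int i + (j + (int s - 1)) \<le> Sup J'.reg_set"
      by (rule cSup_upper) (rule J'.bdd_above_reg_set[OF N])
    then show ?thesis using x by simp
  qed
  then have "Sup J.reg_set \<le> Sup J'.reg_set - (int s - 1)"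
    by (rule cSup_least[OF J.reg_set_nonempty[OF M(2)]])
  then show ?thesis
    by (simp add: J.reg_ideal_eq J'.reg_ideal_eq)
qed


section \<open>Minimal primes of monomial ideals\<close>

definition restrict_keys :: "(exponent \<Rightarrow> bool) \<Rightarrow> 'k::field mpoly \<Rightarrow> 'k mpoly" where
  "restrict_keys Q p = (\<Sum>m\<in>{m \<in> keys p. Q m}. Poly_Mapping.single m (lookup p m))"

lemma lookup_restrict_keys: "lookup (restrict_keys Q p) m = (if Q m then lookup p m else 0)"
  by (auto simp: restrict_keys_def lookup_sum lookup_single when_def in_keys_iff sum.delta)

lemma keys_restrict_keys: "keys (restrict_keys Q p) = {m \<in> keys p. Q m}"
  by (auto simp: in_keys_iff lookup_restrict_keys split: if_splits)

lemma sum_singles: "(\<Sum>m\<in>keys p. Poly_Mapping.single m (lookup p m)) = (p :: 'k::field mpoly)"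
  by (rule poly_mapping_eqI) (auto simp: lookup_sum lookup_single when_def in_keys_iff sum.delta)

lemma monomial_ideal_subsetI:
  fixes J :: "'k::field mpoly set"
  assumes "\<And>p q. p \<in> J \<Longrightarrow> q \<in> J \<Longrightarrow> p + q \<in> J" "0 \<in> J"
    and "\<And>m c. m \<in> M \<Longrightarrow> Poly_Mapping.single m c \<in> J"
  shows "monomial_ideal M \<subseteq> J"
proof
  fix p :: "'k mpoly" assume p: "p \<in> monomial_ideal M"
  have "(\<Sum>m\<in>A. Poly_Mapping.single m (lookup p m)) \<in> J" if "A \<subseteq> keys p" for A
    using finite_subset[OF that finite_keys] that
    by (induction A rule: finite_induct) (use assms p in \<open>auto simp: monomial_ideal_def\<close>)
  from this[OF subset_refl] show "p \<in> J"
    by (simp add: sum_singles)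
qed

text \<open>The product of the forms of lowest weight does not cancel, as there are no zero divisors.\<close>

lemma lowest_weight_mult:
  fixes p q :: "'k::field mpoly" and \<omega> :: "exponent \<Rightarrow> nat"
  assumes \<omega>: "\<And>a b. \<omega> (a + b) = \<omega> a + \<omega> b" and m: "m \<in> keys p" and u: "u \<in> keys q"
  obtains e where "e \<in> keys (p * q)" "\<omega> e \<le> \<omega> m + \<omega> u"
proof -
  define a where "a = Min (\<omega> ` keys p)"
  define b where "b = Min (\<omega> ` keys q)"
  have a: "a \<in> \<omega> ` keys p" "\<And>x. x \<in> keys p \<Longrightarrow> a \<le> \<omega> x"
    unfolding a_def using m by (auto intro!: Min_in)
  have b: "b \<in> \<omega> ` keys q" "\<And>x. x \<in> keys q \<Longrightarrow> b \<le> \<omega> x"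
    unfolding b_def using u by (auto intro!: Min_in)
  define p0 where "p0 = restrict_keys (\<lambda>x. \<omega> x = a) p"
  define q0 where "q0 = restrict_keys (\<lambda>x. \<omega> x = b) q"
  have "keys p0 \<noteq> {}" "keys q0 \<noteq> {}"
    using a(1) b(1) by (auto simp: p0_def q0_def keys_restrict_keys)
  then have "p0 * q0 \<noteq> 0" by auto
  then have "keys (p0 * q0) \<noteq> {}"
    by (metis keys_eq_empty)
  then obtain e where e: "e \<in> keys (p0 * q0)" by blast
  then obtain x y where xy: "e = x + y" "x \<in> keys p0" "y \<in> keys q0"
    using keys_mult by blast
  have we: "\<omega> e = a + b"
    using xy by (simp add: \<omega> p0_def q0_def keys_restrict_keys)
  have p1: "\<omega> x > a" if "x \<in> keys (p - p0)" for x
    using that a(2)[of x] by (auto simp: p0_def in_keys_iff lookup_minus lookup_restrict_keys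
      order.strict_iff_order split: if_splits)
  have q1: "\<omega> x > b" if "x \<in> keys (q - q0)" for x
    using that b(2)[of x] by (auto simp: q0_def in_keys_iff lookup_minus lookup_restrict_keys
      order.strict_iff_order split: if_splits)
  have 1: "e \<notin> keys ((p - p0) * q)"
  proof
    assume "e \<in> keys ((p - p0) * q)"
    then obtain x y where "e = x + y" "x \<in> keys (p - p0)" "y \<in> keys q" using keys_mult by blast
    then show False using p1[of x] b(2)[of y] we by (simp add: \<omega>)
  qed
  have 2: "e \<notin> keys (p0 * (q - q0))"
  proof
    assume "e \<in> keys (p0 * (q - q0))"
    then obtain x y where "e = x + y" "x \<in> keys p0" "y \<in> keys (q - q0)" using keys_mult by blast
    then show False using q1[of y] we by (simp add: \<omega> p0_def keys_restrict_keys)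
  qed
  \<comment> \<open>The last two products only have exponents of weight greater than
    \<open>a + b\<close>, so they cannot cancel \<open>e\<close>.\<close>
  have "p * q = p0 * q0 + (p - p0) * q + p0 * (q - q0)"
    by (simp add: algebra_simps)
  then have "lookup (p * q) e = lookup (p0 * q0) e"
    using 1 2 by (simp add: lookup_add in_keys_iff)
  then have "e \<in> keys (p * q)" using e by (simp add: in_keys_iff)
  moreover have "\<omega> e \<le> \<omega> m + \<omega> u"
    using we a(2)[OF m] b(2)[OF u] by simp
  ultimately show thesis by (rule that)
qed

section \<open>Primes generated by variables\<close>

definition face_prime :: "nat \<Rightarrow> nat set \<Rightarrow> 'k::field mpoly set" where
  "face_prime n F = monomial_ideal {m \<in> exponents n. \<not> keys m \<subseteq> F}"

lemma upset_face_prime: "upset n {m \<in> exponents n. \<not> keys m \<subseteq> F}"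
  by (auto simp: upset_def keys_exponent_add)

lemma not_in_face_prime:
  assumes "p \<in> carrier (mpoly_ring n)" "p \<notin> face_prime n F"
  obtains m where "m \<in> keys p" "off_degree n F m = 0"
  using assms
  by (auto simp: face_prime_def monomial_ideal_def carrier_mpoly_ring off_degree_eq_0_iff subset_iff)

text \<open>With \<open>off_degree n F\<close> as weight, a polynomial outside the ideal has an
  exponent of weight 0. Lowest weights add under multiplication, so a product of two such
  polynomials has one too.\<close>

lemma primeideal_face_prime: "primeideal (face_prime n F :: 'k::field mpoly set) (mpoly_ring n)"
proof (rule primeidealI)
  show "ideal (face_prime n F :: 'k mpoly set) (mpoly_ring n)"
    unfolding face_prime_def by (rule ideal_monomial_ideal[OF upset_face_prime])
  show "cring (mpoly_ring n :: 'k mpoly ring)" by (rule cring_mpoly_ring)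
  have "(1 :: 'k mpoly) \<notin> face_prime n F"
    by (simp add: face_prime_def monomial_ideal_def)
  moreover have "(1 :: 'k mpoly) \<in> carrier (mpoly_ring n)"
    by (simp add: carrier_mpoly_ring)
  ultimately show "carrier (mpoly_ring n) \<noteq> (face_prime n F :: 'k mpoly set)"
    by blast
  fix p q :: "'k mpoly"
  assume pq: "p \<in> carrier (mpoly_ring n)" "q \<in> carrier (mpoly_ring n)" "p \<otimes>\<^bsub>mpoly_ring n\<^esub> q \<in> face_prime n F"
  show "p \<in> face_prime n F \<or> q \<in> face_prime n F"
  proof (rule ccontr)
    assume "\<not> (p \<in> face_prime n F \<or> q \<in> face_prime n F)"
    then obtain m u where m: "m \<in> keys p" "off_degree n F m = 0" and u: "u \<in> keys q" "off_degree n F u = 0"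
      using not_in_face_prime pq by metis
    obtain e where "e \<in> keys (p * q)" "off_degree n F e \<le> off_degree n F m + off_degree n F u"
      using lowest_weight_mult[of "off_degree n F", OF off_degree_add m(1) u(1)] by blast
    then have "e \<in> exponents n" "\<not> keys e \<subseteq> F" "off_degree n F e = 0"
      using pq(3) m u by (auto simp: face_prime_def monomial_ideal_def)
    then show False by (simp add: off_degree_eq_0_iff)
  qed
qed

lemma face_prime_mono_iff:
  assumes "F \<subseteq> {1..n}"
  shows "(face_prime n G :: 'k::field mpoly set) \<subseteq> face_prime n F \<longleftrightarrow> F \<subseteq> G"
proof
  assume *: "(face_prime n G :: 'k mpoly set) \<subseteq> face_prime n F"
  show "F \<subseteq> G"
  proof
    fix v assume v: "v \<in> F"
    show "v \<in> G"
    proof (rule ccontr)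
      assume "v \<notin> G"
      then have "monomial (Poly_Mapping.single v 1) \<in> (face_prime n G :: 'k mpoly set)"
        using v assms by (auto simp: face_prime_def exponents_def)
      then have "monomial (Poly_Mapping.single v 1) \<in> (face_prime n F :: 'k mpoly set)"
        using * by (rule rev_subsetD)
      then show False using v by (simp add: face_prime_def)
    qed
  qed
qed (auto simp: face_prime_def monomial_ideal_def)

lemma monomial_ideal_subset_face_prime:
  assumes "upset n M" "F \<in> faces n M"
  shows "monomial_ideal M \<subseteq> face_prime n F"
  using assms upset_subset[OF assms(1)] by (auto simp: face_prime_def monomial_ideal_def faces_def)

lemma mdeg_single [simp]: "mdeg (Poly_Mapping.single v k) = k"
  by (simp add: mdeg_def)

lemma exponent_remove:
  assumes "0 < lookup m v"
  obtains m' where "m = m' + Poly_Mapping.single v (1::nat)"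
proof
  show "m = (m - Poly_Mapping.single v 1) + Poly_Mapping.single v 1"
    by (rule poly_mapping_eqI) (use assms in \<open>auto simp: lookup_add lookup_minus lookup_single when_def\<close>)
qed

lemma monomial_not_in_prime:
  assumes Q: "primeideal Q (mpoly_ring n)" and F: "F \<subseteq> {1..n}"
    and vars: "\<And>v. v \<in> F \<Longrightarrow> monomial (Poly_Mapping.single v 1) \<notin> Q"
  shows "keys m \<subseteq> F \<Longrightarrow> monomial m \<notin> (Q :: 'k::field mpoly set)"
proof (induction "mdeg m" arbitrary: m rule: less_induct)
  case less
  interpret Q: primeideal Q "mpoly_ring n" by (rule Q)
  show ?case
  proof (cases "keys m = {}")
    case True
    then have "m = 0" by (rule keys_eq_empty)
    then show ?thesis
      using Q.I_notcarr Q.one_imp_carrier by auto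
  next
    case False
    then obtain v where v: "v \<in> keys m" by blast
    then obtain m' where m': "m = m' + Poly_Mapping.single v 1"
      using exponent_remove[of m v] by (auto simp: in_keys_iff)
    have sub: "keys m' \<subseteq> F" "v \<in> F"
      using less.prems v by (auto simp: m' keys_exponent_add)
    have "mdeg m' < mdeg m"
      by (simp add: m')
    then have "monomial m' \<notin> Q" "monomial (Poly_Mapping.single v 1) \<notin> Q"
      using less.hyps sub vars by auto
    moreover have "monomial m' \<in> carrier (mpoly_ring n)" "monomial (Poly_Mapping.single v 1) \<in> carrier (mpoly_ring n)"
      using sub F by (auto simp: carrier_mpoly_ring exponents_def)
    ultimately show ?thesis
      using Q.I_prime[of "monomial m'" "monomial (Poly_Mapping.single v 1)"] by (auto simp: m' monomial_mult)
  qed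
qed

lemma single_carrier: "m \<in> exponents n \<Longrightarrow> Poly_Mapping.single m c \<in> carrier (mpoly_ring n)"
  by (simp add: carrier_mpoly_ring monomial_ideal_def)

text \<open>\<open>F\<close> collects the variables outside \<open>Q\<close>. By primality no
  monomial on \<open>F\<close> lies in \<open>Q\<close>, so none has its exponent in
  \<open>M\<close>; and every variable off \<open>F\<close> is in \<open>Q\<close>.\<close>

lemma prime_contains_face_prime:
  fixes Q :: "'k::field mpoly set"
  assumes M: "upset n M" and Q: "primeideal Q (mpoly_ring n)" and IQ: "monomial_ideal M \<subseteq> Q"
  obtains F where "F \<in> faces n M" "face_prime n F \<subseteq> Q"
proof -
  interpret Q: primeideal Q "mpoly_ring n" by (rule Q)
  define F where "F = {v \<in> {1..n}. monomial (Poly_Mapping.single v 1) \<notin> Q}"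
  have "monomial w \<notin> Q" if "keys w \<subseteq> F" for w
    by (rule monomial_not_in_prime[OF Q _ _ that]) (auto simp: F_def)
  moreover have "(monomial w :: 'k mpoly) \<in> Q" if "w \<in> M" for w
    using IQ that by auto
  moreover have "F \<subseteq> {1..n}"
    by (auto simp: F_def)
  ultimately have "F \<in> faces n M"
    unfolding faces_def by blast
  moreover have "face_prime n F \<subseteq> Q"
    unfolding face_prime_def
  proof (rule monomial_ideal_subsetI)
    show "p + q \<in> Q" if "p \<in> Q" "q \<in> Q" for p q
      using additive_subgroup.a_closed[OF ideal.axioms(1)[OF Q.is_ideal] that] by simp
    show "0 \<in> Q" using additive_subgroup.zero_closed[OF ideal.axioms(1)[OF Q.is_ideal]] by simp
    fix m and c :: 'k assume m: "m \<in> {m \<in> exponents n. \<not> keys m \<subseteq> F}"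
    then obtain v where v: "v \<in> keys m" "v \<in> {1..n}" "v \<notin> F" unfolding exponents_def by blast
    then obtain m' where m': "m = m' + Poly_Mapping.single v 1"
      using exponent_remove[of m v] by (auto simp: in_keys_iff)
    have "Poly_Mapping.single m c = Poly_Mapping.single m' c * monomial (Poly_Mapping.single v 1)"
      by (simp add: m' monomial_def mult_single)
    moreover have "monomial (Poly_Mapping.single v 1) \<in> Q"
      using v by (auto simp: F_def)
    moreover have "Poly_Mapping.single m' c \<in> carrier (mpoly_ring n)"
      using m m' by (intro single_carrier) simp
    ultimately show "Poly_Mapping.single m c \<in> Q"
      using Q.I_l_closed[of "monomial (Poly_Mapping.single v 1)" "Poly_Mapping.single m' c"] by simp
  qed
  ultimately show thesis by (rule that)
qed

text \<open>Every prime over the ideal contains the prime of some face, so the minimal ones are of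
  this form; as larger faces give smaller primes, minimality means that the face is a facet.\<close>

lemma minimal_primes_monomial_ideal:
  assumes M: "upset n M"
  shows "minimal_primes (mpoly_ring n) (monomial_ideal M :: 'k::field mpoly set) = face_prime n ` facets n M"
proof (intro equalityI subsetI)
  fix P :: "'k mpoly set"
  assume "P \<in> minimal_primes (mpoly_ring n) (monomial_ideal M)"
  then have P: "primeideal P (mpoly_ring n)" "monomial_ideal M \<subseteq> P"
    and min: "\<And>Q. primeideal Q (mpoly_ring n) \<Longrightarrow> monomial_ideal M \<subseteq> Q \<Longrightarrow> Q \<subseteq> P \<Longrightarrow> Q = P"
    by (auto simp: minimal_primes_def)
  obtain F where F: "F \<in> faces n M" "face_prime n F \<subseteq> P"
    by (rule prime_contains_face_prime[OF M P])
  have eq: "face_prime n F = P"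
    by (rule min[OF primeideal_face_prime monomial_ideal_subset_face_prime[OF M F(1)] F(2)])
  have "G = F" if G: "G \<in> faces n M" "F \<subseteq> G" for G
  proof -
    have Fn: "F \<subseteq> {1..n}" "G \<subseteq> {1..n}" using F G by (auto simp: faces_def)
    have "face_prime n G \<subseteq> P"
      using face_prime_mono_iff[OF Fn(1), of G, where 'k = 'k] G eq by simp
    then have "face_prime n G = P"
      by (rule min[OF primeideal_face_prime monomial_ideal_subset_face_prime[OF M G(1)]])
    then show ?thesis
      using face_prime_mono_iff[OF Fn(2), of F, where 'k = 'k] G eq by auto
  qed
  then show "P \<in> face_prime n ` facets n M"
    using eq F(1) by (auto simp: facets_def)
next
  fix P :: "'k mpoly set"
  assume "P \<in> face_prime n ` facets n M"
  then obtain F where P: "P = face_prime n F" and F: "F \<in> faces n M" "\<And>G. G \<in> faces n M \<Longrightarrow> F \<subseteq> G \<Longrightarrow> G = F"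
    by (auto simp: facets_def)
  have Fn: "F \<subseteq> {1..n}" using F by (auto simp: faces_def)
  have "Q = P" if Q: "primeideal Q (mpoly_ring n)" "monomial_ideal M \<subseteq> Q" "Q \<subseteq> P" for Q
  proof -
    obtain G where G: "G \<in> faces n M" "face_prime n G \<subseteq> Q"
      by (rule prime_contains_face_prime[OF M Q(1,2)])
    have "F \<subseteq> G"
      using face_prime_mono_iff[OF Fn, of G, where 'k = 'k] G(2) Q(3) P by blast
    then have "G = F" by (rule F(2)[OF G(1)])
    then show ?thesis using G Q P by blast
  qed
  then show "P \<in> minimal_primes (mpoly_ring n) (monomial_ideal M)"
    using primeideal_face_prime monomial_ideal_subset_face_prime[OF M F(1)]
    by (auto simp: minimal_primes_def P)
qed

section \<open>Contraction from the localization at a prime\<close>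

lemma module_fractions_regular_module:
  assumes "primeideal P R"
  shows "module_fractions R (regular_module R) (carrier R - P)"
proof -
  interpret P: primeideal P R by (rule assms)
  have "module R (regular_module R)"
  proof (rule moduleI)
    show "cring R" by (rule P.is_cring)
    show "abelian_group (regular_module R)"
      by (rule abelian_group_cong[OF P.abelian_group_axioms]) (simp_all add: regular_module_def)
  qed (simp_all add: regular_module_def P.l_distr P.r_distr P.m_assoc)
  then show ?thesis
    unfolding module_fractions_def module_fractions_axioms_def
    using P.one_imp_carrier P.I_notcarr P.I_prime by auto
qed

text \<open>An equation \<open>f/1 = a/t\<close> yields the multiplier \<open>w t\<close>, where
  \<open>w\<close> witnesses the equality; conversely \<open>f/1 = (u f)/u\<close>.\<close>

lemma localized_contraction_eq:
  assumes P: "primeideal P R" and J: "ideal J R"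
  shows "localized_contraction R J P = {f \<in> carrier R. \<exists>u\<in>carrier R - P. u \<otimes>\<^bsub>R\<^esub> f \<in> J}"
proof -
  interpret J: ideal J R by (rule J)
  interpret P: primeideal P R by (rule P)
  let ?T = "carrier R - P"
  interpret module_fractions R "regular_module R" ?T
    by (rule module_fractions_regular_module[OF P])
  have car: "carrier (regular_module R) = carrier R" by (simp add: regular_module_def)
  have sm: "r \<odot>\<^bsub>regular_module R\<^esub> x = r \<otimes>\<^bsub>R\<^esub> x" for r x by (simp add: regular_module_def)
  have "frac R (regular_module R) ?T f \<one>\<^bsub>R\<^esub> \<in> {frac R (regular_module R) ?T a t |a t. a \<in> J \<and> t \<in> ?T}
      \<longleftrightarrow> (\<exists>u\<in>?T. u \<otimes>\<^bsub>R\<^esub> f \<in> J)" if f: "f \<in> carrier R" for f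
  proof
    assume "frac R (regular_module R) ?T f \<one>\<^bsub>R\<^esub> \<in> {frac R (regular_module R) ?T a t |a t. a \<in> J \<and> t \<in> ?T}"
    then obtain a t where a: "a \<in> J" "t \<in> ?T" and "frac R (regular_module R) ?T f \<one>\<^bsub>R\<^esub> = frac R (regular_module R) ?T a t"
      by blast
    then obtain w where w: "w \<in> ?T" "w \<otimes>\<^bsub>R\<^esub> (t \<otimes>\<^bsub>R\<^esub> f) = w \<otimes>\<^bsub>R\<^esub> (\<one>\<^bsub>R\<^esub> \<otimes>\<^bsub>R\<^esub> a)"
      using frac_eq_iff[of f a "\<one>\<^bsub>R\<^esub>" t] f T_one J.Icarr car by (auto simp: sm)
    have "w \<otimes>\<^bsub>R\<^esub> t \<in> ?T" using T_mult w(1) a(2) by blast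
    moreover have "(w \<otimes>\<^bsub>R\<^esub> t) \<otimes>\<^bsub>R\<^esub> f = w \<otimes>\<^bsub>R\<^esub> a"
      using w a f J.Icarr by (simp add: J.m_assoc)
    ultimately show "\<exists>u\<in>?T. u \<otimes>\<^bsub>R\<^esub> f \<in> J"
      using J.I_l_closed[OF a(1)] w(1) by (metis DiffD1)
  next
    assume "\<exists>u\<in>?T. u \<otimes>\<^bsub>R\<^esub> f \<in> J"
    then obtain u where u: "u \<in> ?T" "u \<otimes>\<^bsub>R\<^esub> f \<in> J" by blast
    have "frac R (regular_module R) ?T f \<one>\<^bsub>R\<^esub> = frac R (regular_module R) ?T (u \<otimes>\<^bsub>R\<^esub> f) u"
      by (rule frac_eqI) (use f u T_one in \<open>auto simp: car sm\<close>)
    then show "frac R (regular_module R) ?T f \<one>\<^bsub>R\<^esub> \<in> {frac R (regular_module R) ?T a t |a t. a \<in> J \<and> t \<in> ?T}"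
      using u by blast
  qed
  then show ?thesis
    unfolding localized_contraction_def Let_def by blast
qed


section \<open>Ordinary and symbolic powers\<close>

text \<open>The iteration starts at \<open>exponents n\<close> because the zeroth power of an ideal
  is S.\<close>

definition expo_power :: "nat \<Rightarrow> exponent set \<Rightarrow> nat \<Rightarrow> exponent set" where
  "expo_power n M s = ((\<lambda>N. {a + b |a b. a \<in> N \<and> b \<in> M}) ^^ s) (exponents n)"

lemma expo_power_0 [simp]: "expo_power n M 0 = exponents n"
  by (simp add: expo_power_def)

lemma expo_power_Suc: "expo_power n M (Suc s) = {a + b |a b. a \<in> expo_power n M s \<and> b \<in> M}"
  by (simp add: expo_power_def)

lemma ideal_prod_monomial_ideal:
  "ideal_prod (mpoly_ring n) (monomial_ideal M) (monomial_ideal N :: 'k::field mpoly set) =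
    monomial_ideal {a + b |a b. a \<in> M \<and> b \<in> N}"
proof
  show "ideal_prod (mpoly_ring n) (monomial_ideal M) (monomial_ideal N :: 'k mpoly set)
      \<subseteq> monomial_ideal {a + b |a b. a \<in> M \<and> b \<in> N}"
  proof
    fix p :: "'k mpoly"
    assume "p \<in> ideal_prod (mpoly_ring n) (monomial_ideal M) (monomial_ideal N)"
    then show "p \<in> monomial_ideal {a + b |a b. a \<in> M \<and> b \<in> N}"
    proof (induction rule: ideal_prod.induct)
      case (prod i j)
      then show ?case
        using keys_mult[of i j] unfolding monomial_ideal_def mpoly_ring_simps by blast
    next
      case (sum s1 s2)
      then show ?case by (simp add: monomial_ideal_add)
    qed
  qed
  show "monomial_ideal {a + b |a b. a \<in> M \<and> b \<in> N} \<subseteq>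
      ideal_prod (mpoly_ring n) (monomial_ideal M) (monomial_ideal N :: 'k mpoly set)"
  proof (rule monomial_ideal_subsetI)
    show "p + q \<in> ideal_prod (mpoly_ring n) (monomial_ideal M) (monomial_ideal N :: 'k mpoly set)"
      if "p \<in> ideal_prod (mpoly_ring n) (monomial_ideal M) (monomial_ideal N :: 'k mpoly set)"
        "q \<in> ideal_prod (mpoly_ring n) (monomial_ideal M) (monomial_ideal N :: 'k mpoly set)" for p q
      using ideal_prod.sum[OF that] by simp
    show "0 \<in> ideal_prod (mpoly_ring n) (monomial_ideal M) (monomial_ideal N :: 'k mpoly set)"
      using ideal_prod.prod[of "0 :: 'k mpoly" "monomial_ideal M" 0 "monomial_ideal N" "mpoly_ring n"] by simp
    fix m and c :: 'k assume "m \<in> {a + b |a b. a \<in> M \<and> b \<in> N}"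
    then obtain a b where m: "m = a + b" "a \<in> M" "b \<in> N" by blast
    have "Poly_Mapping.single a c \<in> monomial_ideal M" "(monomial b :: 'k mpoly) \<in> monomial_ideal N"
      using m by (auto simp: monomial_ideal_def monomial_def)
    from ideal_prod.prod[OF this, of "mpoly_ring n"]
    show "Poly_Mapping.single m c \<in> ideal_prod (mpoly_ring n) (monomial_ideal M) (monomial_ideal N :: 'k mpoly set)"
      by (simp add: m monomial_def mult_single)
  qed
qed

lemma ideal_power_monomial_ideal:
  "ideal_power n (monomial_ideal M :: 'k::field mpoly set) s = monomial_ideal (expo_power n M s)"
proof (induction s)
  case 0
  then show ?case by (simp add: ideal_power_def ideals_set_def carrier_mpoly_ring)
next
  case (Suc s)
  have "ideal_power n (monomial_ideal M :: 'k mpoly set) (Suc s) =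
      ideal_prod (mpoly_ring n) (ideal_power n (monomial_ideal M) s) (monomial_ideal M)"
    by (simp add: ideal_power_def ideals_set_def)
  then show ?case
    by (simp add: Suc ideal_prod_monomial_ideal expo_power_Suc)
qed

definition generated_below :: "nat \<Rightarrow> nat \<Rightarrow> exponent set \<Rightarrow> bool" where
  "generated_below n d M \<longleftrightarrow>
    (\<forall>m\<in>M. \<exists>a\<in>M. \<exists>w\<in>exponents n. m = a + w \<and> (\<forall>v. lookup a v \<le> d))"

text \<open>If \<open>x_v x^m\<close> is a multiple of a generator whose exponent in
  \<open>v\<close> is at most that of \<open>m\<close>, the cofactor contains \<open>x_v\<close>,
  which can be cancelled.\<close>

lemma generated_below_var_bounded:
  assumes "upset n M" "generated_below n d M"
  shows "var_bounded d M"
  unfolding var_bounded_def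
proof (intro allI impI)
  fix m v assume d: "d \<le> lookup m v" and "m + Poly_Mapping.single v 1 \<in> M"
  then obtain a w where aw: "a \<in> M" "w \<in> exponents n" "m + Poly_Mapping.single v 1 = a + w" "lookup a v \<le> d"
    using assms(2) unfolding generated_below_def by blast
  have "lookup m v + 1 = lookup a v + lookup w v"
    using arg_cong[OF aw(3), of "\<lambda>x. lookup x v"] by (simp add: lookup_add)
  then have "0 < lookup w v" using aw(4) d by linarith
  then obtain w' where w': "w = w' + Poly_Mapping.single v 1"
    by (rule exponent_remove)
  have "m = a + w'"
    using aw(3) unfolding w' by (metis add.assoc add_right_cancel)
  then show "m \<in> M"
    using upsetD[OF assms(1) aw(1)] aw(2) w' by simp
qed

context
  fixes n :: nat and M :: "exponent set"
  assumes M: "upset n M"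
begin

lemma upset_expo_power: "upset n (expo_power n M s)"
proof (induction s)
  case (Suc s)
  show ?case
    unfolding upset_def
  proof (intro conjI ballI)
    show "expo_power n M (Suc s) \<subseteq> exponents n"
      using upset_subset[OF Suc] upset_subset[OF M] by (auto simp: expo_power_Suc)
    fix m w assume "m \<in> expo_power n M (Suc s)" "w \<in> exponents n"
    then obtain a b where "m + w = a + (b + w)" "a \<in> expo_power n M s" "b + w \<in> M"
      using upsetD[OF M] by (auto simp: expo_power_Suc add.assoc)
    then show "m + w \<in> expo_power n M (Suc s)"
      by (auto simp: expo_power_Suc)
  qed
qed (simp add: upset_exponents)

lemma expo_power_generated_below:
  assumes "generated_below n 1 M"
  shows "generated_below n s (expo_power n M s)"
proof (induction s)
  case 0
  have "\<exists>a\<in>exponents n. \<exists>w\<in>exponents n. m = a + w \<and> (\<forall>v. lookup a v \<le> 0)"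
    if "m \<in> exponents n" for m
    by (rule bexI[of _ 0], rule bexI[of _ m]) (use that in simp_all)
  then show ?case by (simp add: generated_below_def)
next
  case (Suc s)
  show ?case
    unfolding generated_below_def
  proof
    fix m assume "m \<in> expo_power n M (Suc s)"
    then obtain a b where m: "m = a + b" "a \<in> expo_power n M s" "b \<in> M" by (auto simp: expo_power_Suc)
    obtain a' w where a: "a' \<in> expo_power n M s" "w \<in> exponents n" "a = a' + w" "\<And>v. lookup a' v \<le> s"
      using Suc m(2) unfolding generated_below_def by blast
    obtain b' u where b: "b' \<in> M" "u \<in> exponents n" "b = b' + u" "\<And>v. lookup b' v \<le> 1"
      using assms m(3) unfolding generated_below_def by blast
    have "m = (a' + b') + (w + u)" by (simp add: m a b ac_simps)
    moreover have "a' + b' \<in> expo_power n M (Suc s)" using a b by (auto simp: expo_power_Suc)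
    moreover have "lookup (a' + b') v \<le> Suc s" for v
      using a(4)[of v] b(4)[of v] by (simp add: lookup_add)
    ultimately show "\<exists>a\<in>expo_power n M (Suc s). \<exists>w\<in>exponents n. m = a + w \<and> (\<forall>v. lookup a v \<le> Suc s)"
      using a(2) b(2) by (intro bexI[of _ "a' + b'"] bexI[of _ "w + u"]) auto
  qed
qed

text \<open>The witness is \<open>m\<close> added up \<open>s\<close> times.\<close>

lemma expo_power_same_keys:
  assumes "m \<in> M"
  shows "\<exists>w\<in>expo_power n M s. keys w \<subseteq> keys m"
proof (induction s)
  case 0
  then show ?case by (auto intro: bexI[of _ 0])
next
  case (Suc s)
  then obtain w where "w \<in> expo_power n M s" "keys w \<subseteq> keys m" by blast
  then show ?case
    using assms by (intro bexI[of _ "w + m"]) (auto simp: expo_power_Suc keys_exponent_add)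
qed

text \<open>No exponent of \<open>M\<close> is supported on a face, so each of the \<open>s\<close>
  summands from \<open>M\<close> contributes at least 1 off \<open>F\<close>.\<close>

lemma expo_power_off_degree:
  assumes F: "F \<in> faces n M"
  shows "m \<in> expo_power n M s \<Longrightarrow> s \<le> off_degree n F m"
proof (induction s arbitrary: m)
  case (Suc s)
  then obtain a b where m: "m = a + b" "a \<in> expo_power n M s" "b \<in> M" by (auto simp: expo_power_Suc)
  have "off_degree n F b \<noteq> 0"
    using F m(3) upset_subset[OF M] by (subst off_degree_eq_0_iff) (auto simp: faces_def)
  then show ?case using Suc.IH[OF m(2)] m(1) by simp
qed simp

text \<open>The exponents of the symbolic power, as \<open>I\<^sup>(\<^sup>s\<^sup>)\<close> is the intersection of the \<open>P\<^sub>F\<^sup>s\<close> over the facets.\<close>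

definition symbolic_expo_power :: "nat \<Rightarrow> exponent set" where
  "symbolic_expo_power s = {m \<in> exponents n. \<forall>F\<in>faces n M. s \<le> off_degree n F m}"

lemma upset_symbolic_expo_power: "upset n (symbolic_expo_power s)"
  by (auto simp: upset_def symbolic_expo_power_def trans_le_add1)

lemma expo_power_subset_symbolic: "expo_power n M s \<subseteq> symbolic_expo_power s"
  using expo_power_off_degree subsetD[OF upset_subset[OF upset_expo_power]]
  by (auto simp: symbolic_expo_power_def)

text \<open>A variable on \<open>F\<close> does not count in the degree off \<open>F\<close>, so
  removing it is harmless; a variable off \<open>F\<close> with exponent at least \<open>s\<close>
  provides the whole bound by itself.\<close>

lemma var_bounded_symbolic_expo_power: "var_bounded s (symbolic_expo_power s)"
  unfolding var_bounded_def
proof (intro allI impI)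
  fix m v assume s: "s \<le> lookup m v" and mv: "m + Poly_Mapping.single v 1 \<in> symbolic_expo_power s"
  have v: "v \<in> {1..n}" and m: "m \<in> exponents n"
    using mv by (auto simp: symbolic_expo_power_def exponents_def keys_exponent_add)
  have "s \<le> off_degree n F m" if F: "F \<in> faces n M" for F
  proof (cases "v \<in> F")
    case True
    then show ?thesis using mv F by (auto simp: symbolic_expo_power_def off_degree_single)
  next
    case False
    then show ?thesis using off_degree_ge[of v n F m] v s by simp
  qed
  then show "m \<in> symbolic_expo_power s" using m by (simp add: symbolic_expo_power_def)
qed

text \<open>For a facet \<open>F\<close> and \<open>v \<notin> F\<close> the monomial \<open>x\<^sub>v x\<^sub>F\<close> lies in \<open>I\<close>, so \<open>I\<close> becomes \<open>P\<^sub>F\<close> once \<open>x\<^sub>F\<close> is inverted.\<close>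

lemma facet_expo_power:
  assumes gen: "generated_below n 1 M" and F: "F \<in> facets n M"
  shows "m \<in> exponents n \<Longrightarrow> s \<le> off_degree n F m \<Longrightarrow>
    \<exists>w\<in>exponents n. keys w \<subseteq> F \<and> lookup w = (\<lambda>v. if v \<in> F then s else 0) \<and> w + m \<in> expo_power n M s"
proof (induction s arbitrary: m)
  case 0
  then show ?case by (auto intro!: bexI[of _ 0])
next
  case (Suc s)
  have Fn: "F \<subseteq> {1..n}" "finite F"
    using F by (auto simp: facets_def faces_def intro: finite_subset)
  have "\<not> keys m \<subseteq> F"
    using Suc.prems off_degree_eq_0_iff[OF Suc.prems(1), of F] by simp
  then obtain v where v: "v \<in> keys m" "v \<notin> F" by blast
  have vn: "v \<in> {1..n}" using v Suc.prems by (auto simp: exponents_def)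
  obtain m' where m': "m = m' + Poly_Mapping.single v 1"
    using v by (metis exponent_remove in_keys_iff neq0_conv)
  have "s \<le> off_degree n F m'"
    using Suc.prems(2) by (simp add: m' off_degree_single v vn split: if_splits)
  then obtain w where w: "w \<in> exponents n" "keys w \<subseteq> F" "lookup w = (\<lambda>v. if v \<in> F then s else 0)"
    "w + m' \<in> expo_power n M s"
    using Suc.IH[of m'] Suc.prems(1) m' by auto
  \<comment> \<open>Maximality of \<open>F\<close> provides a monomial of the ideal supported on
    \<open>insert v F\<close>.\<close>
  have "insert v F \<notin> faces n M"
    using F v(2) by (auto simp: facets_def)
  then obtain u where u: "keys u \<subseteq> insert v F" "u \<in> M"
    using Fn vn by (auto simp: faces_def)
  then obtain a x where a: "a \<in> M" "x \<in> exponents n" "u = a + x" "\<And>y. lookup a y \<le> 1"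
    using gen unfolding generated_below_def by blast
  \<comment> \<open>The squarefree generator \<open>a\<close> divides \<open>x_v x_F\<close>. Using
    this product instead of \<open>a\<close> keeps the multiplier equal to \<open>s\<close> on all
    of \<open>F\<close>, independently of \<open>m\<close>.\<close>
  define b where "b = Poly_Mapping.single v 1 + indicator_exponent F"
  have ab: "lookup a y \<le> lookup b y" for y
  proof (cases "y \<in> insert v F")
    case True
    then have "1 \<le> lookup b y"
      by (auto simp: b_def lookup_add lookup_indicator_exponent Fn lookup_single)
    then show ?thesis using a(4)[of y] by linarith
  next
    case False
    then have "y \<notin> keys a" using u a(3) by (auto simp: keys_exponent_add)
    then show ?thesis by (simp add: in_keys_iff)
  qed
  have "b = a + (b - a)"
    by (rule poly_mapping_eqI) (use ab in \<open>simp add: lookup_add lookup_minus\<close>)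
  moreover have bn: "b \<in> exponents n"
    using vn Fn by (auto simp: b_def exponents_def keys_indicator_exponent keys_exponent_add)
  moreover have "b - a \<in> exponents n"
    using bn keys_diff_exponent[of b a] by (auto simp: exponents_def)
  ultimately have "b \<in> M" using upsetD[OF M a(1)] by metis
  then have "(w + m') + b \<in> expo_power n M (Suc s)"
    using w(4) by (auto simp: expo_power_Suc)
  moreover have "(w + m') + b = (w + indicator_exponent F) + m"
    by (simp add: b_def m' ac_simps)
  ultimately show ?case
    using w Fn
    by (intro bexI[of _ "w + indicator_exponent F"])
      (auto simp: keys_exponent_add keys_indicator_exponent lookup_add lookup_indicator_exponent exponents_def fun_eq_iff)
qed

text \<open>An element \<open>u\<close> outside the prime of a facet has an exponent of degree 0 off
  it, so by lowest weights the degree of any exponent of \<open>f\<close> is at least that of some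
  exponent of \<open>u * f\<close>. Conversely \<open>x_F^s\<close> moves all monomials of
  sufficient degree off \<open>F\<close> into the ordinary power.\<close>

lemma symbolic_power_monomial_ideal:
  assumes gen: "generated_below n 1 M" and proper: "0 \<notin> M"
  shows "symbolic_power n (monomial_ideal M :: 'k::field mpoly set) s = monomial_ideal (symbolic_expo_power s)"
proof -
  let ?R = "mpoly_ring n :: 'k mpoly ring"
  let ?J = "monomial_ideal (expo_power n M s) :: 'k mpoly set"
  have contraction: "localized_contraction ?R ?J (face_prime n F) =
      {f \<in> carrier ?R. \<exists>u\<in>carrier ?R - face_prime n F. u * f \<in> ?J}" for F
    using localized_contraction_eq[OF primeideal_face_prime[of n F] ideal_monomial_ideal[OF upset_expo_power[of s]]]
    by simp
  have sym: "symbolic_power n (monomial_ideal M :: 'k mpoly set) s =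
      (\<Inter>F\<in>facets n M. {f \<in> carrier ?R. \<exists>u\<in>carrier ?R - face_prime n F. u * f \<in> ?J})"
    unfolding symbolic_power_def minimal_primes_monomial_ideal[OF M] ideal_power_monomial_ideal
    by (simp add: contraction)
  \<comment> \<open>A facet exists, so the intersection runs over a nonempty family and its elements
    lie in S.\<close>
  have "{} \<in> faces n M" using proper by (auto simp: faces_def)
  then obtain F0 where F0: "F0 \<in> facets n M" by (rule face_in_facet)
  show ?thesis
  proof (intro equalityI subsetI)
    fix f :: "'k mpoly" assume "f \<in> symbolic_power n (monomial_ideal M) s"
    then have f: "f \<in> carrier ?R"
      and ex: "\<And>F. F \<in> facets n M \<Longrightarrow> \<exists>u\<in>carrier ?R - face_prime n F. u * f \<in> ?J"
      using F0 unfolding sym by blast+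
    have "s \<le> off_degree n F m" if F: "F \<in> faces n M" and m: "m \<in> keys f" for F m
    proof -
      \<comment> \<open>Bounds on facets suffice: passing to a smaller face can only raise the
        degree off it.\<close>
      obtain G where G: "G \<in> facets n M" "F \<subseteq> G" using F by (rule face_in_facet)
      obtain u where u: "u \<in> carrier ?R" "u \<notin> face_prime n G" "u * f \<in> ?J"
        using ex[OF G(1)] by blast
      obtain x where x: "x \<in> keys u" "off_degree n G x = 0"
        using u(1,2) by (rule not_in_face_prime)
      obtain e where e: "e \<in> keys (u * f)" "off_degree n G e \<le> off_degree n G x + off_degree n G m"
        using off_degree_add x(1) m by (rule lowest_weight_mult)
      have "e \<in> expo_power n M s" using e(1) u(3) by (auto simp: monomial_ideal_def)
      then have "s \<le> off_degree n G e"
        using G(1) by (intro expo_power_off_degree) (simp_all add: facets_def)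
      also have "\<dots> \<le> off_degree n G m" using e(2) x(2) by simp
      also have "\<dots> \<le> off_degree n F m" by (rule off_degree_antimono[OF G(2)])
      finally show ?thesis .
    qed
    then show "f \<in> monomial_ideal (symbolic_expo_power s)"
      using f by (auto simp: monomial_ideal_def symbolic_expo_power_def carrier_mpoly_ring)
  next
    fix f :: "'k mpoly" assume f: "f \<in> monomial_ideal (symbolic_expo_power s)"
    have fR: "f \<in> carrier ?R"
      using f by (auto simp: monomial_ideal_def symbolic_expo_power_def carrier_mpoly_ring)
    have "\<exists>u\<in>carrier ?R - face_prime n F. u * f \<in> ?J" if F: "F \<in> facets n M" for F
    proof -
      have ex: "\<exists>w\<in>exponents n. keys w \<subseteq> F \<and> lookup w = (\<lambda>v. if v \<in> F then s else 0) \<and> w + m \<in> expo_power n M s"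
        if "m \<in> exponents n" "s \<le> off_degree n F m" for m
        using facet_expo_power[OF gen F that] .
      have "F \<in> faces n M" using F by (simp add: facets_def)
      have Fn: "F \<subseteq> {1..n}" "finite F"
        using F by (auto simp: facets_def faces_def intro: finite_subset)
      \<comment> \<open>The multiplier found for a single exponent depends only on \<open>F\<close>
        and \<open>s\<close>, so one monomial serves all exponents of \<open>f\<close>.\<close>
      define W where "W = (\<Sum>v\<in>F. Poly_Mapping.single v s)"
      have W: "lookup W = (\<lambda>v. if v \<in> F then s else 0)"
        by (auto simp: W_def lookup_sum lookup_single when_def sum.delta Fn)
      have keysW: "keys W \<subseteq> F" by (auto simp: in_keys_iff W split: if_splits)
      have "W + m \<in> expo_power n M s" if m: "m \<in> keys f" for m
      proof -
        have "m \<in> exponents n" "s \<le> off_degree n F m"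
          using f m \<open>F \<in> faces n M\<close> by (auto simp: monomial_ideal_def symbolic_expo_power_def)
        then obtain w where "lookup w = (\<lambda>v. if v \<in> F then s else 0)" "w + m \<in> expo_power n M s"
          using ex by blast
        then show ?thesis using W by (metis poly_mapping_eq_iff)
      qed
      then have "monomial W * f \<in> ?J"
        by (auto simp: monomial_ideal_def keys_monomial_mult)
      moreover have "monomial W \<in> carrier ?R" "monomial W \<notin> (face_prime n F :: 'k mpoly set)"
        using keysW Fn by (auto simp: carrier_mpoly_ring exponents_def face_prime_def)
      ultimately show ?thesis by blast
    qed
    then show "f \<in> symbolic_power n (monomial_ideal M) s"
      using fR unfolding sym by blast
  qed
qed

end

section \<open>From squarefree generators to exponent sets, and the inequality\<close>

lemma squarefree_monomial_ideal_exponents: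
  assumes "squarefree_monomial_ideal n (I :: 'k::field mpoly set)"
  obtains M where "I = monomial_ideal M" "upset n M" "generated_below n 1 M"
proof -
  obtain A where A: "\<And>m. m \<in> A \<Longrightarrow> m \<in> exponents n \<and> squarefree_exponent m"
    and I: "I = genideal (mpoly_ring n) (monomial ` A)"
    using assms by (auto simp: squarefree_monomial_ideal_def exponents_def)
  interpret cring "mpoly_ring n :: 'k mpoly ring" by (rule cring_mpoly_ring)
  define M where "M = {a + w |a w. a \<in> A \<and> w \<in> exponents n}"
  have M: "upset n M"
    using A unfolding upset_def M_def by (fastforce simp: add.assoc)
  have AM: "a \<in> M" if "a \<in> A" for a
    unfolding M_def using that zero_exponents by (metis (mono_tags, lifting) add.right_neutral mem_Collect_eq)
  have car: "monomial ` A \<subseteq> carrier (mpoly_ring n :: 'k mpoly ring)"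
    using A by (auto simp: carrier_mpoly_ring)
  interpret I: ideal I "mpoly_ring n"
    unfolding I by (rule genideal_ideal[OF car])
  have "I \<subseteq> monomial_ideal M"
    unfolding I by (rule genideal_minimal[OF ideal_monomial_ideal[OF M]]) (auto simp: AM)
  moreover have "monomial_ideal M \<subseteq> I"
  proof (rule monomial_ideal_subsetI)
    show "p + q \<in> I" if "p \<in> I" "q \<in> I" for p q
      using additive_subgroup.a_closed[OF ideal.axioms(1)[OF I.is_ideal] that] by simp
    show "0 \<in> I"
      using additive_subgroup.zero_closed[OF ideal.axioms(1)[OF I.is_ideal]] by simp
    fix m and c :: 'k assume "m \<in> M"
    then obtain a w where m: "m = a + w" "a \<in> A" "w \<in> exponents n" by (auto simp: M_def)
    have "monomial a \<in> I"
      unfolding I using genideal_self[OF car] m(2) by blast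
    from I.I_l_closed[OF this single_carrier[OF m(3), of c]]
    show "Poly_Mapping.single m c \<in> I"
      by (simp add: m monomial_def mult_single add.commute)
  qed
  moreover have "generated_below n 1 M"
    unfolding generated_below_def
  proof
    fix m assume "m \<in> M"
    then obtain a w where m: "m = a + w" "a \<in> A" "w \<in> exponents n" by (auto simp: M_def)
    then show "\<exists>a\<in>M. \<exists>w\<in>exponents n. m = a + w \<and> (\<forall>v. lookup a v \<le> 1)"
      using A[OF m(2)] AM[OF m(2)] by (auto simp: squarefree_exponent_def)
  qed
  ultimately show thesis using that M by blast
qed

theorem lemma1p4:
  fixes n s :: nat
    and I :: "'k::field mpoly set"
  assumes "squarefree_monomial_ideal n I"
    and "I \<noteq> {0}"
    and "I \<noteq> carrier (mpoly_ring n)"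
    and "s \<ge> 1"
  shows "reg_ideal n I + int s - 1 \<le>
    min (reg_ideal n (ideal_power n I s)) (reg_ideal n (symbolic_power n I s))"
proof -
  obtain M where I: "I = monomial_ideal M" and M: "upset n M" "generated_below n 1 M"
    using assms(1) by (rule squarefree_monomial_ideal_exponents)
  have proper: "0 \<notin> M"
    using assms(3) unfolding I by (rule zero_exponent_not_in_monomial_ideal[OF M(1)])
  have nonzero: "M \<noteq> {}"
  proof
    assume "M = {}"
    then have "p = 0" if "p \<in> I" for p
      using that by (intro keys_eq_empty) (auto simp: I monomial_ideal_def)
    then show False using assms(2) monomial_ideal_zero[of M] I by blast
  qed
  have bounded: "var_bounded 1 M"
    by (rule generated_below_var_bounded[OF M])
  have quot: "monomial_quotient n N (monomial_ideal N :: 'k mpoly set)" if "upset n N" for N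
    by unfold_locales (use that in simp_all)
  have "reg_ideal n I + int s - 1 \<le> reg_ideal n (ideal_power n I s)"
    unfolding I ideal_power_monomial_ideal
    by (rule reg_ideal_comparison[OF quot[OF M(1)] quot[OF upset_expo_power[OF M(1)]] bounded proper nonzero])
      (use assms(4) M expo_power_same_keys expo_power_off_degree
        generated_below_var_bounded[OF upset_expo_power expo_power_generated_below] in auto)
  moreover have "reg_ideal n I + int s - 1 \<le> reg_ideal n (symbolic_power n I s)"
    unfolding I symbolic_power_monomial_ideal[OF M proper]
  proof (rule reg_ideal_comparison[OF quot[OF M(1)] quot[OF upset_symbolic_expo_power[OF M(1)]] bounded proper nonzero])
    \<comment> \<open>The witness comes from the ordinary power, which lies in the symbolic
      one.\<close>
    show "\<exists>w\<in>symbolic_expo_power n M s. keys w \<subseteq> keys m" if "m \<in> M" for m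
      using expo_power_same_keys[OF M(1) that] expo_power_subset_symbolic[OF M(1)] by blast
  qed (use assms(4) M var_bounded_symbolic_expo_power in \<open>auto simp: symbolic_expo_power_def\<close>)
  ultimately show ?thesis by simp
qed

end
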